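(* Assume the pairwise stationarity assumption stated in the context, that $\nu<\infty$, that $\limsup_{t\to\infty}e^{-\nu t}\mathbb E[N_t]<\infty$, and that there exists $K>0$ such that $$\lim_{t\to\infty}\ \sup_{\tau\ge0}\left|e^{-\nu(2t+\tau)}\sum_{n=1}^\infty\sum_{m=1}^\infty\sum_{k=0}^{\min(n,m)-1}\mathbb E\Big[A_{n,m,k}\,\mathbf 1_{\{S_{n-1}\le t,\ S^{(k)}_{m-1}\le t+\tau\}}\Big]-K\right|=0.$$ Then there exists a square integrable random variable $W$ such that $(e^{-\nu t}N_t)_{t\ge0}$ converges in quadratic mean to $W$ as $t\to\infty$. If moreover there exists $\varepsilon>0$ such that $$\sup_{\tau\ge0}\left|e^{-\nu(2t+\tau)}\sum_{n=1}^\infty\sum_{m=1}^\infty\sum_{k=0}^{\min(n,m)-1}\mathbb E\Big[A_{n,m,k}\,\mathbf 1_{\{S_{n-1}\le t,\ S^{(k)}_{m-1}\le t+\tau\}}\Big]-K\right|=O(e^{-\varepsilon t})\quad\text{as }t\to\infty$$ (i.e. the convergence to $0$ of this supremum is exponentially fast) and if $W>0$ (almost surely), then $(e^{-\nu t}N_t)_{t\ge0}$ converges almost surely to $W$ as $t\to\infty$.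
   Context: Branching model. $(\mathbb X,\mathcal X)$ is a measurable space, $\xi:\mathbb X\to[0,+\infty)$ and $\kappa:\mathbb X\to\{2,3,\dots\}$ are measurable functions, and $(X_n)_{n\ge 0}$ is an $\mathbb X$-valued process. Cells are labelled by finite sequences $v=(k_1,\dots,k_n)$ of positive integers ($n$ is the generation of $v$; the empty sequence labels the single initial cell, born at time $0$). To each label $v$ is attached an $\mathbb X$-valued random variable $X_v$ in such a way that, along every infinite line of descent $(v_n)_{n\ge0}$ ($v_0=\emptyset$ and $v_{n+1}$ is obtained from $v_n$ by appending one positive integer), the process $(X_{v_n})_{n\ge 0}$ has the same law as $(X_n)_{n\ge 0}$. A cell $v$ has lifetime $\xi(X_v)$ and at the end of its lifetime it splits into $\kappa(X_v)$ new cells, labelled by appending $1,\dots,\kappa(X_v)$ to $v$. Thus $v=(k_1,\dots,k_n)$ actually occurs iff $k_{i+1}\le\kappa(X_{(k_1,\dots,k_i)})$ for $0\le i<n$, and it is then alive at time $t$ iff $\sum_{i=0}^{n-1}\xi(X_{(k_1,\dots,k_i)})\le t<\sum_{i=0}^{n}\xi(X_{(k_1,\dots,k_i)})$. $N_t$ is the number of cells alive at time $t$. Pairwise stationarity assumption. For each integer $k\ge0$ there is a process $X^{(k)}=(X^{(k)}_n)_{n\ge0}$ (defined jointly with $X=(X_n)_{n\ge0}$) such that $(X^{(k)}_n)_{0\le n\le k}=(X_n)_{0\le n\le k}$ a.s., $(X^{(k)}_n)_{n\ge0}$ has the same law as $(X_n)_{n\ge0}$, and, for every pair of lines of cells $((v_n)_n,(w_n)_n)$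 coinciding up to the $k$-th generation but not at the $(k+1)$-th generation, the corresponding pair of sequences of parameters has the same distribution as $(X,X^{(k)})$. Notation. $S_n:=\sum_{j=0}^n\xi(X_j)$, $S^{(k)}_n:=\sum_{j=0}^n\xi(X^{(k)}_j)$ and, for integers $n,m\ge1$ and $0\le k\le\min(n,m)-1$, $$A_{n,m,k}=\Big(\prod_{i=0}^{n-2}\kappa(X_i)\Big)\Big(\prod_{j=\min(k+1,n-1)}^{m-2}\kappa(X^{(k)}_j)\Big)\Big(\prod_{j\in\{k\}\setminus\{n-1,m-1\}}(\kappa(X_j)-1)\Big)(\kappa(X_{n-1})-1)(\kappa(X^{(k)}_{m-1})-1),$$ empty products being equal to $1$. Moreover $\nu:=\inf\big\{\gamma>0:\ \sum_{n\ge0}\mathbb E\big[(\prod_{j=0}^{n-1}\kappa(X_j))(\kappa(X_n)-1)e^{-\gamma S_n}\big]<\infty\big\}$. *)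

theory Defs
  imports "HOL-Probability.Probability"
begin

definition cell_label :: "nat list \<Rightarrow> bool" where
  "cell_label v \<longleftrightarrow> (\<forall>i\<in>set v. 1 \<le> i)"

definition line_of_descent :: "(nat \<Rightarrow> nat list) \<Rightarrow> bool" where
  "line_of_descent v \<longleftrightarrow> v 0 = [] \<and> (\<forall>n. \<exists>j\<ge>1. v (Suc n) = v n @ [j])"

definition process_law ::
  "'w measure \<Rightarrow> 'x measure \<Rightarrow> (nat \<Rightarrow> 'w \<Rightarrow> 'x) \<Rightarrow> (nat \<Rightarrow> 'x) measure" where
  "process_law M E X = distr M (\<Pi>\<^sub>M n\<in>UNIV. E) (\<lambda>\<omega> n. X n \<omega>)"

definition process_pair_law ::
  "'w measure \<Rightarrow> 'x measure \<Rightarrow> (nat \<Rightarrow> 'w \<Rightarrow> 'x) \<Rightarrow> (nat \<Rightarrow> 'w \<Rightarrow> 'x)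
     \<Rightarrow> ((nat \<Rightarrow> 'x) \<times> (nat \<Rightarrow> 'x)) measure" where
  "process_pair_law M E X Y =
     distr M ((\<Pi>\<^sub>M n\<in>UNIV. E) \<Otimes>\<^sub>M (\<Pi>\<^sub>M n\<in>UNIV. E)) (\<lambda>\<omega>. (\<lambda>n. X n \<omega>, \<lambda>n. Y n \<omega>))"

text \<open>
  The parameters \<open>C v\<close> of the cells live on the probability space \<open>M\<close>; the typical line
  of descent \<open>X\<close> lives on a possibly different probability space \<open>P\<close>, since only its law
  is tied to that of the cells.  Parameters are attached to all labels, whether or not the
  corresponding cell occurs.
\<close>

locale branching_model =
  cells: prob_space M + line: prob_space P
  for M :: "'w measure" and P :: "'p measure" +
  fixes E :: "'x measure"
    and \<xi> :: "'x \<Rightarrow> real" and \<kappa> :: "'x \<Rightarrow> nat"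
    and C :: "nat list \<Rightarrow> 'w \<Rightarrow> 'x"
    and X :: "nat \<Rightarrow> 'p \<Rightarrow> 'x"
  assumes lifetime_measurable: "\<xi> \<in> borel_measurable E"
    and lifetime_nonneg: "\<And>x. x \<in> space E \<Longrightarrow> 0 \<le> \<xi> x"
    and offspring_measurable: "\<kappa> \<in> measurable E (count_space UNIV)"
    and offspring_ge_2: "\<And>x. x \<in> space E \<Longrightarrow> 2 \<le> \<kappa> x"
    and cell_measurable: "\<And>v. cell_label v \<Longrightarrow> C v \<in> measurable M E"
    and process_measurable: "\<And>n. X n \<in> measurable P E"
    and line_law: "\<And>v. line_of_descent v \<Longrightarrow>
          process_law M E (\<lambda>n. C (v n)) = process_law P E X"

definition pairwise_stationary ::
  "'w measure \<Rightarrow> 'p measure \<Rightarrow> 'x measure \<Rightarrow> (nat list \<Rightarrow> 'w \<Rightarrow> 'x)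
     \<Rightarrow> (nat \<Rightarrow> 'p \<Rightarrow> 'x) \<Rightarrow> (nat \<Rightarrow> nat \<Rightarrow> 'p \<Rightarrow> 'x) \<Rightarrow> bool" where
  "pairwise_stationary M P E C X Xk \<longleftrightarrow>
     (\<forall>k.
        (\<forall>n. Xk k n \<in> measurable P E) \<and>
        (AE \<omega> in P. \<forall>n\<le>k. Xk k n \<omega> = X n \<omega>) \<and>
        process_law P E (Xk k) = process_law P E X \<and>
        (\<forall>v w. line_of_descent v \<longrightarrow> line_of_descent w \<longrightarrow>
            (\<forall>i\<le>k. v i = w i) \<longrightarrow> v (Suc k) \<noteq> w (Suc k) \<longrightarrow>
            process_pair_law M E (\<lambda>n. C (v n)) (\<lambda>n. C (w n)) = process_pair_law P E X (Xk k)))"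

text \<open>
  The list \<open>take i v\<close> is the ancestor of \<open>v\<close> in generation \<open>i\<close>, and \<open>v ! i\<close> is its
  rank among its siblings in generation \<open>i + 1\<close>.
\<close>

definition cell_occurs ::
  "('x \<Rightarrow> nat) \<Rightarrow> (nat list \<Rightarrow> 'w \<Rightarrow> 'x) \<Rightarrow> 'w \<Rightarrow> nat list \<Rightarrow> bool" where
  "cell_occurs \<kappa> C \<omega> v \<longleftrightarrow>
     cell_label v \<and> (\<forall>i<length v. v ! i \<le> \<kappa> (C (take i v) \<omega>))"

definition cell_alive ::
  "('x \<Rightarrow> real) \<Rightarrow> ('x \<Rightarrow> nat) \<Rightarrow> (nat list \<Rightarrow> 'w \<Rightarrow> 'x) \<Rightarrow> real \<Rightarrow> 'w \<Rightarrow> nat list \<Rightarrow> bool" where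
  "cell_alive \<xi> \<kappa> C t \<omega> v \<longleftrightarrow>
     cell_occurs \<kappa> C \<omega> v \<and>
     (\<Sum>i<length v. \<xi> (C (take i v) \<omega>)) \<le> t \<and>
     t < (\<Sum>i\<le>length v. \<xi> (C (take i v) \<omega>))"

text \<open>The number of cells alive may a priori be infinite, so \<open>card\<close> is not used.\<close>

definition num_alive ::
  "('x \<Rightarrow> real) \<Rightarrow> ('x \<Rightarrow> nat) \<Rightarrow> (nat list \<Rightarrow> 'w \<Rightarrow> 'x) \<Rightarrow> real \<Rightarrow> 'w \<Rightarrow> ennreal" where
  "num_alive \<xi> \<kappa> C t \<omega> = emeasure (count_space UNIV) {v. cell_alive \<xi> \<kappa> C t \<omega> v}"

definition split_time ::
  "('x \<Rightarrow> real) \<Rightarrow> (nat \<Rightarrow> 'p \<Rightarrow> 'x) \<Rightarrow> nat \<Rightarrow> 'p \<Rightarrow> real" where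
  "split_time \<xi> X n \<omega> = (\<Sum>j\<le>n. \<xi> (X j \<omega>))"

text \<open>The infimum is taken in the extended reals, so that it is \<open>\<infinity>\<close> for the empty set.\<close>

definition malthusian ::
  "'p measure \<Rightarrow> ('x \<Rightarrow> real) \<Rightarrow> ('x \<Rightarrow> nat) \<Rightarrow> (nat \<Rightarrow> 'p \<Rightarrow> 'x) \<Rightarrow> ereal" where
  "malthusian P \<xi> \<kappa> X =
     Inf (ereal ` {\<gamma>. 0 < \<gamma> \<and>
       (\<Sum>n. \<integral>\<^sup>+ \<omega>. ennreal (real (\<Prod>j<n. \<kappa> (X j \<omega>)) * (real (\<kappa> (X n \<omega>)) - 1)
                       * exp (- \<gamma> * split_time \<xi> X n \<omega>)) \<partial>P) < \<infinity>})"

text \<open>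
  Used for \<open>n, m \<ge> 1\<close> and \<open>k < min n m\<close> only, with \<open>Y\<close> the process \<open>X\<^sup>(\<^sup>k\<^sup>)\<close>.  The upper
  limits \<open>n - 2\<close> and \<open>m - 2\<close> of the products are written as strict bounds \<open>n - 1\<close> and
  \<open>m - 1\<close>, so that the products are empty when \<open>n = 1\<close> or \<open>m = 1\<close>.
\<close>

definition pair_weight ::
  "('x \<Rightarrow> nat) \<Rightarrow> (nat \<Rightarrow> 'p \<Rightarrow> 'x) \<Rightarrow> (nat \<Rightarrow> 'p \<Rightarrow> 'x) \<Rightarrow> nat \<Rightarrow> nat \<Rightarrow> nat \<Rightarrow> 'p \<Rightarrow> real" where
  "pair_weight \<kappa> X Y n m k \<omega> =
     (\<Prod>i\<in>{0..<n - 1}. real (\<kappa> (X i \<omega>))) *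
     (\<Prod>j\<in>{min (k + 1) (n - 1)..<m - 1}. real (\<kappa> (Y j \<omega>))) *
     (\<Prod>j\<in>{k} - {n - 1, m - 1}. (real (\<kappa> (X j \<omega>)) - 1)) *
     (real (\<kappa> (X (n - 1) \<omega>)) - 1) * (real (\<kappa> (Y (m - 1) \<omega>)) - 1)"

text \<open>The summation indices are shifted: \<open>Suc n\<close> and \<open>Suc m\<close> range over the integers \<open>\<ge> 1\<close>.\<close>

definition pair_sum ::
  "'p measure \<Rightarrow> ('x \<Rightarrow> real) \<Rightarrow> ('x \<Rightarrow> nat) \<Rightarrow> (nat \<Rightarrow> 'p \<Rightarrow> 'x) \<Rightarrow> (nat \<Rightarrow> nat \<Rightarrow> 'p \<Rightarrow> 'x)
     \<Rightarrow> real \<Rightarrow> real \<Rightarrow> ennreal" where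
  "pair_sum P \<xi> \<kappa> X Xk s t =
     (\<Sum>n. \<Sum>m. \<Sum>k<min (Suc n) (Suc m).
        \<integral>\<^sup>+ \<omega>. ennreal (pair_weight \<kappa> X (Xk k) (Suc n) (Suc m) k \<omega>)
               * indicator {\<omega>. split_time \<xi> X n \<omega> \<le> s \<and> split_time \<xi> (Xk k) m \<omega> \<le> t} \<omega> \<partial>P)"

definition pair_deviation ::
  "'p measure \<Rightarrow> ('x \<Rightarrow> real) \<Rightarrow> ('x \<Rightarrow> nat) \<Rightarrow> (nat \<Rightarrow> 'p \<Rightarrow> 'x) \<Rightarrow> (nat \<Rightarrow> nat \<Rightarrow> 'p \<Rightarrow> 'x)
     \<Rightarrow> real \<Rightarrow> real \<Rightarrow> real \<Rightarrow> ereal" where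
  "pair_deviation P \<xi> \<kappa> X Xk \<nu> K t =
     (SUP \<tau>\<in>{0..}. \<bar>ereal (exp (- \<nu> * (2 * t + \<tau>))) * enn2ereal (pair_sum P \<xi> \<kappa> X Xk t (t + \<tau>))
                    - ereal K\<bar>)"

text \<open>
  Convergence is stated in the extended reals, without truncating infinite values of the
  process: an infinite value is at infinite distance from the real-valued limit.
\<close>

definition converges_in_quadratic_mean ::
  "'w measure \<Rightarrow> (real \<Rightarrow> 'w \<Rightarrow> ereal) \<Rightarrow> ('w \<Rightarrow> real) \<Rightarrow> bool" where
  "converges_in_quadratic_mean M Z W \<longleftrightarrow>
     ((\<lambda>t. \<integral>\<^sup>+ \<omega>. e2ennreal (\<bar>Z t \<omega> - ereal (W \<omega>)\<bar>\<^sup>2) \<partial>M) \<longlongrightarrow> 0) at_top"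

definition converges_almost_surely ::
  "'w measure \<Rightarrow> (real \<Rightarrow> 'w \<Rightarrow> ereal) \<Rightarrow> ('w \<Rightarrow> real) \<Rightarrow> bool" where
  "converges_almost_surely M Z W \<longleftrightarrow>
     (AE \<omega> in M. ((\<lambda>t. Z t \<omega>) \<longlongrightarrow> ereal (W \<omega>)) at_top)"

definition normalized_num_alive ::
  "('x \<Rightarrow> real) \<Rightarrow> ('x \<Rightarrow> nat) \<Rightarrow> (nat list \<Rightarrow> 'w \<Rightarrow> 'x) \<Rightarrow> real \<Rightarrow> real \<Rightarrow> 'w \<Rightarrow> ereal" where
  "normalized_num_alive \<xi> \<kappa> C \<nu> t \<omega> = ereal (exp (- \<nu> * t)) * enn2ereal (num_alive \<xi> \<kappa> C t \<omega>)"

end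

(*
  A split of a cell v adds kappa(X_v) - 1 cells, so N_t = 1 + D_t, where D_t is the sum of
  kappa(X_v) - 1 over the cells v that have split by time t.  Expanding D_s D_t over pairs of cells
  and sorting the pairs (v, w) by their generations and by the generation k of their last common
  ancestor, pairwise stationarity replaces the two lines by (X, X^(k)); counting the pairs of labels
  produces exactly the weights A_{n,m,k}, so that E[D_s D_t] is the triple sum of the hypothesis.
  Hence e^{-nu (s+t)} E[D_s D_t] tends to K as s, t tend to infinity, so Z_t = e^{-nu t} D_t is
  Cauchy in L^2, and by Fatou its limit V satisfies E[(V - Z_t)^2] <= 3 delta(t), with delta(t) the
  supremum in the hypothesis.  If delta decays exponentially, Z tends to V almost surely along every
  grid of mesh 1/(j+1), and since D is nondecreasing the values of Z between grid points are
  controlled up to factors e^{nu/(j+1)}.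
*)

theory Submission
  imports Defs
begin

section \<open>Gains of splits\<close>

text \<open>The argument is a whole parameter sequence rather than the family \<open>C\<close>, so
  that this is a single measurable function on path space and its expectations can be moved between
  lines with equal laws. The time sum includes the index \<open>length v\<close>: it is the split
  time of the cell, not its birth time.\<close>

definition line_gain ::
  "('x \<Rightarrow> real) \<Rightarrow> ('x \<Rightarrow> nat) \<Rightarrow> real \<Rightarrow> nat list \<Rightarrow> (nat \<Rightarrow> 'x) \<Rightarrow> ennreal" where
  "line_gain \<xi> \<kappa> t v x =
     (if (\<forall>i<length v. v ! i \<in> {1..\<kappa> (x i)}) \<and> (\<Sum>i\<le>length v. \<xi> (x i)) \<le> t
      then ennreal (real (\<kappa> (x (length v))) - 1) else 0)"

text \<open>This is D_t. The sum over labels is an integral for counting measure, so that Tonelli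
  applies; lists of cells that do not occur or have not split contribute 0.\<close>

definition total_gain ::
  "('x \<Rightarrow> real) \<Rightarrow> ('x \<Rightarrow> nat) \<Rightarrow> (nat list \<Rightarrow> 'w \<Rightarrow> 'x) \<Rightarrow> real \<Rightarrow> 'w \<Rightarrow> ennreal" where
  "total_gain \<xi> \<kappa> C t \<omega> =
     (\<integral>\<^sup>+ v. line_gain \<xi> \<kappa> t v (\<lambda>i. C (take i v) \<omega>) \<partial>count_space UNIV)"

lemma line_gain_cong:
  assumes "\<And>i. i \<le> length v \<Longrightarrow> x i = y i"
  shows "line_gain \<xi> \<kappa> t v x = line_gain \<xi> \<kappa> t v y"
  unfolding line_gain_def using assms by (auto intro!: sum.cong)

lemma line_gain_mono: "s \<le> t \<Longrightarrow> line_gain \<xi> \<kappa> s v x \<le> line_gain \<xi> \<kappa> t v x"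
  by (auto simp: line_gain_def)

lemma total_gain_mono: "s \<le> t \<Longrightarrow> total_gain \<xi> \<kappa> C s \<omega> \<le> total_gain \<xi> \<kappa> C t \<omega>"
  unfolding total_gain_def by (intro nn_integral_mono line_gain_mono)

subsection \<open>Cells alive and cells that have split\<close>

lemma cell_occurs_iff:
  "cell_occurs \<kappa> C \<omega> v \<longleftrightarrow> (\<forall>i<length v. v ! i \<in> {1..\<kappa> (C (take i v) \<omega>)})"
  unfolding cell_occurs_def cell_label_def
  by (auto simp: all_set_conv_all_nth Suc_le_eq)

lemma cell_occurs_snoc:
  "cell_occurs \<kappa> C \<omega> (v @ [j]) \<longleftrightarrow> cell_occurs \<kappa> C \<omega> v \<and> j \<in> {1..\<kappa> (C v \<omega>)}"
  unfolding cell_occurs_iff by (auto simp: nth_append less_Suc_eq)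

text \<open>Cells born by time \<open>t\<close> are counted in two ways: each is alive or has
  already split, and each is the initial cell or a child of a cell that has split.\<close>

lemma num_alive_eq_total_gain:
  assumes t: "0 \<le> t"
    and \<kappa>: "\<And>v. cell_label v \<Longrightarrow> 2 \<le> \<kappa> (C v \<omega>)"
    and \<xi>: "\<And>v. cell_label v \<Longrightarrow> 0 \<le> \<xi> (C v \<omega>)"
    and fin: "total_gain \<xi> \<kappa> C t \<omega> < \<infinity>"
  shows "num_alive \<xi> \<kappa> C t \<omega> = 1 + total_gain \<xi> \<kappa> C t \<omega>"
proof -
  define death where "death v = (\<Sum>i\<le>length v. \<xi> (C (take i v) \<omega>))" for v
  define Q where "Q = {v. cell_occurs \<kappa> C \<omega> v \<and> death v \<le> t}"
  define A where "A = {v. cell_alive \<xi> \<kappa> C t \<omega> v}"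
  define k where "k v = \<kappa> (C v \<omega>)" for v
  have lab: "cell_label v" if "v \<in> Q" for v
    using that by (simp add: Q_def cell_occurs_def)
  have k2: "2 \<le> k v" if "v \<in> Q" for v
    using \<kappa>[OF lab[OF that]] by (simp add: k_def)
  have gain: "line_gain \<xi> \<kappa> t v (\<lambda>i. C (take i v) \<omega>) = ennreal (real (k v) - 1) * indicator Q v" for v
    by (auto simp: line_gain_def Q_def death_def cell_occurs_iff k_def indicator_def)
  have tot: "total_gain \<xi> \<kappa> C t \<omega> = (\<integral>\<^sup>+ v. ennreal (real (k v) - 1) \<partial>count_space Q)"
    unfolding total_gain_def gain by (rule nn_integral_count_space_indicator[symmetric]) simp
  \<comment> \<open>As \<open>\<kappa>\<close> is at least 2, each split gains at least 1, so a
    finite total gain leaves only finitely many splits.\<close>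
  have "emeasure (count_space Q) Q = (\<integral>\<^sup>+ v. 1 \<partial>count_space Q)"
    by simp
  also have "\<dots> \<le> total_gain \<xi> \<kappa> C t \<omega>"
    unfolding tot
  proof (rule nn_integral_mono)
    fix v assume "v \<in> space (count_space Q)"
    then have "1 \<le> real (k v) - 1" using k2[of v] by simp
    then show "1 \<le> ennreal (real (k v) - 1)" by (metis ennreal_1 ennreal_leI)
  qed
  finally have "finite Q"
    using fin by (metis emeasure_count_space_infinite infinity_ennreal_def leD order_refl)
  have birth: "(\<Sum>i<length (v @ [j]). \<xi> (C (take i (v @ [j])) \<omega>)) = death v" for v j
    unfolding death_def by (auto intro!: sum.cong simp: lessThan_Suc_atMost)
  \<comment> \<open>Both sides describe the cells born by time \<open>t\<close>; the root is on the
    left because \<open>0 \<le> t\<close>.\<close>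
  have AQ: "A \<union> Q = insert [] ((\<lambda>(v, j). v @ [j]) ` (SIGMA v:Q. {1..k v}))" (is "?L = ?R")
  proof (intro set_eqI)
    fix u show "u \<in> ?L \<longleftrightarrow> u \<in> ?R"
    proof (cases u rule: rev_cases)
      case Nil
      then show ?thesis using t
        by (auto simp: A_def Q_def cell_alive_def death_def cell_occurs_iff)
    next
      case (snoc v j)
      have "cell_alive \<xi> \<kappa> C t \<omega> u \<longleftrightarrow> cell_occurs \<kappa> C \<omega> u \<and> death v \<le> t \<and> t < death u"
        by (simp only: cell_alive_def birth snoc death_def[of "v @ [j]"])
      then have "u \<in> ?L \<longleftrightarrow> cell_occurs \<kappa> C \<omega> u \<and> (death v \<le> t \<and> t < death u \<or> death u \<le> t)"
        by (auto simp: A_def Q_def)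
      also have "\<dots> \<longleftrightarrow> cell_occurs \<kappa> C \<omega> u \<and> death v \<le> t"
      proof -
        \<comment> \<open>Lifetimes are nonnegative, so a cell that has split by time
          \<open>t\<close> was also born by time \<open>t\<close>.\<close>
        have "death v \<le> death u" if "cell_occurs \<kappa> C \<omega> u"
        proof -
          have "0 \<le> \<xi> (C u \<omega>)" using that \<xi> by (auto simp: cell_occurs_def)
          moreover have "death u = death v + \<xi> (C u \<omega>)"
            unfolding snoc birth[of v j, symmetric] death_def[of "v @ [j]"]
            by (simp add: lessThan_Suc_atMost[symmetric])
          ultimately show ?thesis by simp
        qed
        then show ?thesis by auto
      qed
      also have "\<dots> \<longleftrightarrow> u \<in> ?R"
        unfolding snoc cell_occurs_snoc by (auto simp: Q_def k_def)
      finally show ?thesis .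
    qed
  qed
  have finR: "finite (SIGMA v:Q. {1..k v})" using \<open>finite Q\<close> by auto
  then have "finite (A \<union> Q)" unfolding AQ by simp
  then have "finite A" by simp
  have "A \<inter> Q = {}" by (auto simp: A_def Q_def cell_alive_def death_def)
  then have "card A + card Q = card (A \<union> Q)"
    using \<open>finite A\<close> \<open>finite Q\<close> by (simp add: card_Un_disjoint)
  also have "\<dots> = Suc (card ((\<lambda>(v, j). v @ [j]) ` (SIGMA v:Q. {1..k v})))"
    unfolding AQ using finR by (subst card_insert_disjoint) auto
  also have "\<dots> = Suc (\<Sum>v\<in>Q. k v)"
    using \<open>finite Q\<close> by (subst card_image) (auto simp: inj_on_def)
  finally have "real (card A) + real (card Q) = 1 + (\<Sum>v\<in>Q. real (k v))"
    by (metis of_nat_Suc of_nat_add of_nat_sum add.commute)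
  then have "real (card A) = 1 + (\<Sum>v\<in>Q. real (k v) - 1)"
    by (simp add: sum_subtractf)
  moreover have nonneg: "0 \<le> real (k v) - 1" if "v \<in> Q" for v using k2[OF that] by simp
  ultimately have "ennreal (real (card A)) = 1 + (\<Sum>v\<in>Q. ennreal (real (k v) - 1))"
    by (simp add: ennreal_plus sum_nonneg)
  then show ?thesis
    unfolding num_alive_def A_def[symmetric] tot using \<open>finite A\<close> \<open>finite Q\<close>
    by (simp add: nn_integral_count_space_finite ennreal_of_nat_eq_real_of_nat)
qed

subsection \<open>Pairs of labels\<close>

text \<open>All labels are tested against the same sequence \<open>x\<close>, as happens once the
  lines of cells have been replaced by \<open>X\<close> and \<open>Xk k\<close>; their number is
  then a product.\<close>

definition admissible :: "('x \<Rightarrow> nat) \<Rightarrow> (nat \<Rightarrow> 'x) \<Rightarrow> nat \<Rightarrow> nat list set" where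
  "admissible \<kappa> x n = {v. length v = n \<and> (\<forall>i<n. v ! i \<in> {1..\<kappa> (x i)})}"

text \<open>
  When one label is a prefix of the other, \<open>k\<close> is the length of the shorter one.
\<close>

definition diverge_at :: "nat \<Rightarrow> nat list \<Rightarrow> nat list \<Rightarrow> bool" where
  "diverge_at k v w \<longleftrightarrow> k \<le> length v \<and> k \<le> length w \<and> take k w = take k v \<and>
     (k < length v \<longrightarrow> k < length w \<longrightarrow> v ! k \<noteq> w ! k)"

text \<open>The index is the length of the longest common prefix.\<close>

lemma diverge_at_exists: "\<exists>k. diverge_at k v w"
proof -
  define P where "P k \<longleftrightarrow> k \<le> length v \<and> k \<le> length w \<and> take k w = take k v" for k
  have "P 0" by (simp add: P_def)
  moreover have bound: "k \<le> length v" if "P k" for k using that by (simp add: P_def)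
  ultimately have g: "P (Greatest P)" by (rule GreatestI_nat)
  have "\<not> P (Suc (Greatest P))"
    using Greatest_le_nat[of P "Suc (Greatest P)" "length v"] bound by auto
  with g have "diverge_at (Greatest P) v w"
    by (auto simp: diverge_at_def P_def take_Suc_conv_app_nth)
  then show ?thesis ..
qed

text \<open>At a smaller index the labels would have to differ, although they share the longer
  prefix. Used in both orders, this gives uniqueness of the index.\<close>

lemma diverge_at_le:
  assumes "diverge_at k v w" "diverge_at l v w"
  shows "l \<le> k"
proof (rule ccontr)
  assume "\<not> l \<le> k"
  then have "k < l" by simp
  moreover from this assms have "v ! k = w ! k"
    unfolding diverge_at_def by (metis nth_take)
  ultimately show False using assms by (auto simp: diverge_at_def)
qed

text \<open>Exactly one \<open>k\<close> fits a pair, and it is at most both lengths, so inserting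
  this sum sorts pairs by \<open>k\<close> without changing their weight.\<close>

lemma sum_diverge_at:
  fixes c :: "'a::semiring_1"
  shows "(\<Sum>k<min (Suc (length v)) (Suc (length w)). if diverge_at k v w then c else 0) = c"
proof -
  obtain k where k: "diverge_at k v w" using diverge_at_exists by blast
  have "diverge_at l v w \<longleftrightarrow> l = k" for l
    using k diverge_at_le by (meson le_antisym)
  then have "(\<Sum>l<min (Suc (length v)) (Suc (length w)). if diverge_at l v w then c else 0)
    = (\<Sum>l<min (Suc (length v)) (Suc (length w)). if l = k then c else 0)"
    by simp
  also have "\<dots> = c" using k by (subst sum.delta) (auto simp: diverge_at_def)
  finally show ?thesis .
qed

section \<open>Counting labels along fixed parameter sequences\<close>

text \<open>Each further generation appends one of \<open>\<kappa> (x m)\<close> ranks, so every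
  induction step multiplies the count by that number.\<close>

lemma finite_card_admissible_extending:
  assumes "k \<le> m" "u \<in> admissible \<kappa> x k"
  shows "finite {w \<in> admissible \<kappa> x m. take k w = u} \<and>
    card {w \<in> admissible \<kappa> x m. take k w = u} = (\<Prod>j\<in>{k..<m}. \<kappa> (x j))"
  using assms(1)
proof (induction m rule: dec_induct)
  case base
  have "{w \<in> admissible \<kappa> x k. take k w = u} = {u}"
    using assms(2) by (auto simp: admissible_def)
  then show ?case by simp
next
  case (step m)
  let ?S = "{w \<in> admissible \<kappa> x m. take k w = u}"
  have "{w \<in> admissible \<kappa> x (Suc m). take k w = u} = (\<lambda>(w, j). w @ [j]) ` (?S \<times> {1..\<kappa> (x m)})"
    (is "?L = ?R")
  proof (intro set_eqI)
    fix w' show "w' \<in> ?L \<longleftrightarrow> w' \<in> ?R"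
    proof (cases w' rule: rev_cases)
      case Nil
      then show ?thesis by (auto simp: admissible_def)
    next
      case (snoc w j)
      then show ?thesis using \<open>k \<le> m\<close>
        by (auto simp: admissible_def nth_append less_Suc_eq image_iff)
    qed
  qed
  moreover have "inj_on (\<lambda>(w, j). w @ [j]) (?S \<times> {1..\<kappa> (x m)})"
    by (auto simp: inj_on_def)
  ultimately show ?case using step
    by (simp add: card_image card_cartesian_product prod.atLeastLessThan_Suc)
qed

lemma finite_card_admissible:
  "finite (admissible \<kappa> x n)" "card (admissible \<kappa> x n) = (\<Prod>j<n. \<kappa> (x j))"
  using finite_card_admissible_extending[of 0 n "[]" \<kappa> x]
  by (auto simp: admissible_def atLeast0LessThan)

text \<open>If \<open>k\<close> is the length of one of the labels, every extension of the common
  prefix counts. Otherwise the extensions sharing one more rank with \<open>v\<close> are removed,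
  and the difference of two products leaves the factor \<open>\<kappa> (x k) - 1\<close>. The terms
  \<open>min (k + 1) n\<close> and \<open>{k} - {n, m}\<close> cover both cases at once.\<close>

lemma card_admissible_diverge_at:
  assumes "k \<le> n" "k \<le> m" and v: "v \<in> admissible \<kappa> x n" and eq: "\<And>i. i \<le> k \<Longrightarrow> x i = y i"
  shows "real (card {w \<in> admissible \<kappa> y m. diverge_at k v w}) =
    (\<Prod>j\<in>{min (k + 1) n..<m}. real (\<kappa> (y j))) * (\<Prod>j\<in>{k} - {n, m}. real (\<kappa> (x j)) - 1)"
proof -
  have len: "length v = n" using v by (simp add: admissible_def)
  \<comment> \<open>Agreement of \<open>x\<close> and \<open>y\<close> up to index \<open>k\<close>
    also covers the prefix of length \<open>k + 1\<close>, whose extensions are the ones to be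
    removed.\<close>
  have take: "take i v \<in> admissible \<kappa> y i" if "i \<le> n" "i \<le> Suc k" for i
    using v that by (auto simp: admissible_def eq[symmetric])
  let ?T = "\<lambda>i. {w \<in> admissible \<kappa> y m. take i w = take i v}"
  note cardT = finite_card_admissible_extending[OF _ take]
  show ?thesis
  proof (cases "k = n \<or> k = m")
    case True
    have "{w \<in> admissible \<kappa> y m. diverge_at k v w} = ?T k"
      using True assms(1,2) len by (auto simp: diverge_at_def admissible_def)
    moreover have "card (?T k) = (\<Prod>j\<in>{k..<m}. \<kappa> (y j))"
      using cardT[of k m] assms(1,2) by simp
    moreover have "{min (k + 1) n..<m} = {k..<m}" "{k} - {n, m} = {}" using True assms(1,2) by auto
    ultimately show ?thesis by simp
  next
    case False
    then have less: "k < n" "k < m" using assms(1,2) by auto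
    have D: "{w \<in> admissible \<kappa> y m. diverge_at k v w} = ?T k - ?T (Suc k)"
      using less len by (auto simp: diverge_at_def admissible_def take_Suc_conv_app_nth)
    have sub: "?T (Suc k) \<subseteq> ?T k"
      using less len by (auto simp: admissible_def take_Suc_conv_app_nth)
    have fin: "finite (?T k)" and ck: "card (?T k) = (\<Prod>j\<in>{k..<m}. \<kappa> (y j))"
      using cardT[of k m] less by simp_all
    have cS: "card (?T (Suc k)) = (\<Prod>j\<in>{Suc k..<m}. \<kappa> (y j))"
      using cardT[of "Suc k" m] less by simp
    have "real (card {w \<in> admissible \<kappa> y m. diverge_at k v w}) =
        real (card (?T k)) - real (card (?T (Suc k)))"
      unfolding D card_Diff_subset[OF finite_subset[OF sub fin] sub]
      by (rule of_nat_diff[OF card_mono[OF fin sub]])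
    also have "\<dots> = (\<Prod>j\<in>{k..<m}. real (\<kappa> (y j))) - (\<Prod>j\<in>{Suc k..<m}. real (\<kappa> (y j)))"
      unfolding ck cS of_nat_prod ..
    also have "(\<Prod>j\<in>{k..<m}. real (\<kappa> (y j))) = real (\<kappa> (x k)) * (\<Prod>j\<in>{Suc k..<m}. real (\<kappa> (y j)))"
      using less eq by (simp add: prod.atLeast_Suc_lessThan)
    finally have "real (card {w \<in> admissible \<kappa> y m. diverge_at k v w}) =
        (\<Prod>j\<in>{Suc k..<m}. real (\<kappa> (y j))) * (real (\<kappa> (x k)) - 1)"
      by (simp add: algebra_simps)
    moreover have "min (k + 1) n = Suc k" "{k} - {n, m} = {k}" using less by auto
    ultimately show ?thesis by simp
  qed
qed

text \<open>The number of partners \<open>w\<close> is the same for every \<open>v\<close>, so the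
  pair count factorises.\<close>

lemma card_admissible_pairs:
  fixes \<kappa> :: "'x \<Rightarrow> nat"
  assumes "k \<le> n" "k \<le> m" and eq: "\<And>i. i \<le> k \<Longrightarrow> x i = y i"
  defines "A \<equiv> SIGMA v:admissible \<kappa> x n. {w \<in> admissible \<kappa> y m. diverge_at k v w}"
  shows "finite A"
    and "real (card A) = (\<Prod>i\<in>{0..<n}. real (\<kappa> (x i))) *
      (\<Prod>j\<in>{min (k + 1) n..<m}. real (\<kappa> (y j))) * (\<Prod>j\<in>{k} - {n, m}. real (\<kappa> (x j)) - 1)"
proof -
  show "finite A" unfolding A_def using finite_card_admissible(1) by (intro finite_SigmaI) auto
  have "real (card A) = (\<Sum>v\<in>admissible \<kappa> x n. real (card {w \<in> admissible \<kappa> y m. diverge_at k v w}))"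
    unfolding A_def using finite_card_admissible(1)[of \<kappa> x n] finite_card_admissible(1)[of \<kappa> y m]
    by (simp add: card_SigmaI)
  also have "\<dots> = (\<Sum>v\<in>admissible \<kappa> x n. (\<Prod>j\<in>{min (k + 1) n..<m}. real (\<kappa> (y j))) *
      (\<Prod>j\<in>{k} - {n, m}. real (\<kappa> (x j)) - 1))"
    by (intro sum.cong card_admissible_diverge_at assms(1-3) refl)
  finally show "real (card A) = (\<Prod>i\<in>{0..<n}. real (\<kappa> (x i))) *
      (\<Prod>j\<in>{min (k + 1) n..<m}. real (\<kappa> (y j))) * (\<Prod>j\<in>{k} - {n, m}. real (\<kappa> (x j)) - 1)"
    using finite_card_admissible(2)[of \<kappa> x n] by (simp add: atLeast0LessThan algebra_simps)
qed

text \<open>Within one class the product of gains is constant on the admissible pairs and 0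
  elsewhere, so the sum is that constant times the pair count. This is the origin of
  \<open>pair_weight\<close>; its arguments are \<open>Suc n\<close> and \<open>Suc m\<close>
  because generations start at 0.\<close>

lemma nn_integral_line_gain_pairs:
  fixes \<kappa> :: "'x \<Rightarrow> nat" and X Y :: "nat \<Rightarrow> 'p \<Rightarrow> 'x"
  assumes "k \<le> n" "k \<le> m" and eq: "\<And>i. i \<le> k \<Longrightarrow> X i \<omega> = Y i \<omega>"
    and \<kappa>: "\<And>i. 1 \<le> \<kappa> (X i \<omega>)" "\<And>i. 1 \<le> \<kappa> (Y i \<omega>)"
  shows "(\<integral>\<^sup>+ p. (if length (fst p) = n \<and> length (snd p) = m \<and> diverge_at k (fst p) (snd p)
        then line_gain \<xi> \<kappa> s (fst p) (\<lambda>i. X i \<omega>) * line_gain \<xi> \<kappa> t (snd p) (\<lambda>i. Y i \<omega>) else 0)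
        \<partial>count_space UNIV)
    = ennreal (pair_weight \<kappa> X Y (Suc n) (Suc m) k \<omega>)
      * indicator {\<omega>. split_time \<xi> X n \<omega> \<le> s \<and> split_time \<xi> Y m \<omega> \<le> t} \<omega>"
    (is "(\<integral>\<^sup>+ p. ?f p \<partial>_) = _ * ?i")
proof -
  define A where "A = (SIGMA v:admissible \<kappa> (\<lambda>i. X i \<omega>) n.
      {w \<in> admissible \<kappa> (\<lambda>i. Y i \<omega>) m. diverge_at k v w})"
  have card: "finite A" "real (card A) = (\<Prod>i\<in>{0..<n}. real (\<kappa> (X i \<omega>))) *
      (\<Prod>j\<in>{min (k + 1) n..<m}. real (\<kappa> (Y j \<omega>))) * (\<Prod>j\<in>{k} - {n, m}. real (\<kappa> (X j \<omega>)) - 1)"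
    unfolding A_def
    by (rule card_admissible_pairs[where x="\<lambda>i. X i \<omega>" and y="\<lambda>i. Y i \<omega>", OF assms(1-3)], assumption)+
  let ?c = "ennreal (real (\<kappa> (X n \<omega>)) - 1) * ennreal (real (\<kappa> (Y m \<omega>)) - 1) * ?i"
  have "?f p = ?c * indicator A p" for p
    by (cases p) (auto simp: A_def admissible_def line_gain_def split_time_def indicator_def)
  then have "(\<integral>\<^sup>+ p. ?f p \<partial>count_space UNIV) = ?c * emeasure (count_space UNIV) A"
    by (simp add: nn_integral_cmult_indicator)
  also have "emeasure (count_space UNIV) A = ennreal (real (card A))"
    using card(1) by (simp add: ennreal_of_nat_eq_real_of_nat)
  also have "?c * ennreal (real (card A)) =
      ennreal (real (card A) * (real (\<kappa> (X n \<omega>)) - 1) * (real (\<kappa> (Y m \<omega>)) - 1)) * ?i"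
    using \<kappa> by (simp add: ennreal_mult' ennreal_mult'' mult_ac)
  also have "real (card A) * (real (\<kappa> (X n \<omega>)) - 1) * (real (\<kappa> (Y m \<omega>)) - 1)
     = pair_weight \<kappa> X Y (Suc n) (Suc m) k \<omega>"
    unfolding card(2) pair_weight_def by simp
  finally show ?thesis .
qed

subsection \<open>Second moments\<close>

lemma line_of_descent_label: "line_of_descent V \<Longrightarrow> cell_label (V n)"
proof (induction n)
  case (Suc n)
  then obtain j where "1 \<le> j" "V (Suc n) = V n @ [j]" unfolding line_of_descent_def by blast
  with Suc show ?case by (auto simp: cell_label_def)
qed (simp add: line_of_descent_def cell_label_def)

lemma line_of_descent_map: "(\<And>i. 1 \<le> a i) \<Longrightarrow> line_of_descent (\<lambda>i. map a [0..<i])"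
  by (auto simp: line_of_descent_def)

text \<open>Pairwise stationarity speaks of infinite lines, gains of finite labels, so the labels
  are prolonged. If one is a prefix of the other, the separation after generation \<open>k\<close>
  is created by the prolongation; for equal labels the default ranks 1 and 2 do this.\<close>

lemma diverging_lines:
  assumes v: "cell_label v" and w: "cell_label w" and k: "diverge_at k v w"
  obtains V W where "line_of_descent V" "line_of_descent W"
    "\<And>i. i \<le> length v \<Longrightarrow> V i = take i v" "\<And>i. i \<le> length w \<Longrightarrow> W i = take i w"
    "\<And>i. i \<le> k \<Longrightarrow> V i = W i" "V (Suc k) \<noteq> W (Suc k)"
proof -
  \<comment> \<open>past its end, each label is continued so as to separate the lines at index \<open>k\<close>\<close>
  define a where "a i = (if i < length v then v ! i else if k < length w then Suc (w ! k) else 1)" for i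
  define b where "b i = (if i < length w then w ! i else if k < length v then Suc (v ! k) else 2)" for i
  have "1 \<le> a i" "1 \<le> b i" for i
    using v w by (auto simp: a_def b_def cell_label_def Suc_le_eq)
  then have "line_of_descent (\<lambda>i. map a [0..<i])" "line_of_descent (\<lambda>i. map b [0..<i])"
    by (auto intro: line_of_descent_map)
  moreover have "map a [0..<i] = take i v" if "i \<le> length v" for i
    using that by (auto simp: a_def intro!: nth_equalityI)
  moreover have "map b [0..<i] = take i w" if "i \<le> length w" for i
    using that by (auto simp: b_def intro!: nth_equalityI)
  moreover have "a i = b i" if "i < k" for i
    using k that nth_take[OF that, of v] nth_take[OF that, of w]
    by (auto simp: a_def b_def diverge_at_def)
  then have "map a [0..<i] = map b [0..<i]" if "i \<le> k" for i
    using that by auto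
  moreover have "a k \<noteq> b k" using k by (auto simp: a_def b_def diverge_at_def)
  then have "map a [0..<Suc k] \<noteq> map b [0..<Suc k]" by simp
  ultimately show thesis by (rule that)
qed

lemma line_gain_not_label: "\<not> cell_label v \<Longrightarrow> line_gain \<xi> \<kappa> t v x = 0"
  by (auto simp: line_gain_def cell_label_def all_set_conv_all_nth Suc_le_eq)

section \<open>Measurability of gains\<close>

context branching_model
begin

lemma line_gain_measurable [measurable]:
  "line_gain \<xi> \<kappa> t v \<in> borel_measurable (\<Pi>\<^sub>M n\<in>UNIV. E)"
proof -
  note [measurable] = lifetime_measurable offspring_measurable
  show ?thesis unfolding line_gain_def[abs_def] by measurable
qed

lemma process_path_measurable:
  assumes "\<And>n. Y n \<in> measurable N E"
  shows "(\<lambda>\<omega> n. Y n \<omega>) \<in> measurable N (\<Pi>\<^sub>M n\<in>UNIV. E)"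
  using assms by (intro measurable_PiM_single') (auto dest: measurable_space)

lemma cell_path_measurable:
  "line_of_descent V \<Longrightarrow> (\<lambda>\<omega> n. C (V n) \<omega>) \<in> measurable M (\<Pi>\<^sub>M n\<in>UNIV. E)"
  by (intro process_path_measurable cell_measurable line_of_descent_label)

text \<open>Measurability of \<open>C\<close> is available at labels only, so other lists are
  handled through their zero gain. Pairing a label with itself in \<open>diverging_lines\<close>
  yields an infinite line through it.\<close>

lemma cell_gain_measurable:
  "(\<lambda>\<omega>. line_gain \<xi> \<kappa> t v (\<lambda>i. C (take i v) \<omega>)) \<in> borel_measurable M"
proof (cases "cell_label v")
  case True
  have "diverge_at (length v) v v" by (simp add: diverge_at_def)
  then obtain V where V: "line_of_descent V" "\<And>i. i \<le> length v \<Longrightarrow> V i = take i v"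
    using diverging_lines[OF True True] by metis
  have "(\<lambda>\<omega>. line_gain \<xi> \<kappa> t v (\<lambda>i. C (V i) \<omega>)) \<in> borel_measurable M"
    using measurable_compose[OF cell_path_measurable[OF V(1)] line_gain_measurable] .
  moreover have "line_gain \<xi> \<kappa> t v (\<lambda>i. C (V i) \<omega>) = line_gain \<xi> \<kappa> t v (\<lambda>i. C (take i v) \<omega>)" for \<omega>
    using V(2) by (intro line_gain_cong) simp
  ultimately show ?thesis by simp
qed (simp add: line_gain_not_label)

lemma total_gain_measurable: "total_gain \<xi> \<kappa> C t \<in> borel_measurable M"
proof -
  interpret L: sigma_finite_measure "count_space (UNIV :: nat list set)"
    by (rule sigma_finite_measure_count_space_countable) simp
  have "(\<lambda>(v, \<omega>). line_gain \<xi> \<kappa> t v (\<lambda>i. C (take i v) \<omega>))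
      \<in> borel_measurable (count_space UNIV \<Otimes>\<^sub>M M)"
    by (intro measurable_pair_measure_countable1) (simp_all add: cell_gain_measurable)
  then show ?thesis
    unfolding total_gain_def[abs_def]
    by (intro L.borel_measurable_nn_integral) (simp add: measurable_pair_swap_iff[of _ M] case_prod_beta)
qed

section \<open>Expectations of products of gains\<close>

text \<open>The product of the two gains is a measurable function of a pair of paths, so its
  expectation depends only on the joint law, which pairwise stationarity identifies.\<close>

lemma nn_integral_cell_gain_pair:
  assumes pw: "pairwise_stationary M P E C X Xk" and k: "diverge_at k v w"
  shows "(\<integral>\<^sup>+ \<omega>. line_gain \<xi> \<kappa> s v (\<lambda>i. C (take i v) \<omega>) * line_gain \<xi> \<kappa> t w (\<lambda>i. C (take i w) \<omega>) \<partial>M)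
    = (\<integral>\<^sup>+ \<omega>. line_gain \<xi> \<kappa> s v (\<lambda>i. X i \<omega>) * line_gain \<xi> \<kappa> t w (\<lambda>i. Xk k i \<omega>) \<partial>P)"
proof (cases "cell_label v \<and> cell_label w")
  case True
  then obtain V W where VW: "line_of_descent V" "line_of_descent W"
    "\<And>i. i \<le> length v \<Longrightarrow> V i = take i v" "\<And>i. i \<le> length w \<Longrightarrow> W i = take i w"
    "\<And>i. i \<le> k \<Longrightarrow> V i = W i" "V (Suc k) \<noteq> W (Suc k)"
    using diverging_lines[OF _ _ k] by metis
  have Xk: "\<And>n. Xk k n \<in> measurable P E"
    and law: "process_pair_law M E (\<lambda>n. C (V n)) (\<lambda>n. C (W n)) = process_pair_law P E X (Xk k)"
    using pw VW unfolding pairwise_stationary_def by blast+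
  let ?S = "(\<Pi>\<^sub>M n\<in>UNIV. E) \<Otimes>\<^sub>M (\<Pi>\<^sub>M n\<in>UNIV. E)"
  let ?F = "\<lambda>p. line_gain \<xi> \<kappa> s v (fst p) * line_gain \<xi> \<kappa> t w (snd p)"
  have F: "?F \<in> borel_measurable ?S" by measurable
  have "(\<integral>\<^sup>+ \<omega>. line_gain \<xi> \<kappa> s v (\<lambda>i. C (take i v) \<omega>) * line_gain \<xi> \<kappa> t w (\<lambda>i. C (take i w) \<omega>) \<partial>M)
     = (\<integral>\<^sup>+ \<omega>. ?F (\<lambda>i. C (V i) \<omega>, \<lambda>i. C (W i) \<omega>) \<partial>M)"
    using VW(3,4) by (intro nn_integral_cong arg_cong2[where f="(*)"]) (auto intro!: line_gain_cong)
  also have "\<dots> = (\<integral>\<^sup>+ p. ?F p \<partial>process_pair_law M E (\<lambda>n. C (V n)) (\<lambda>n. C (W n)))"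
    unfolding process_pair_law_def
    by (intro nn_integral_distr[symmetric] measurable_Pair cell_path_measurable VW) (simp add: F)
  also have "\<dots> = (\<integral>\<^sup>+ p. ?F p \<partial>process_pair_law P E X (Xk k))"
    unfolding law ..
  also have "\<dots> = (\<integral>\<^sup>+ \<omega>. ?F (\<lambda>i. X i \<omega>, \<lambda>i. Xk k i \<omega>) \<partial>P)"
    unfolding process_pair_law_def
    by (intro nn_integral_distr measurable_Pair process_path_measurable process_measurable Xk) (simp add: F)
  finally show ?thesis by simp
qed (auto simp: line_gain_not_label)

lemma second_moment_total_gain:
  assumes pw: "pairwise_stationary M P E C X Xk"
  shows "(\<integral>\<^sup>+ \<omega>. total_gain \<xi> \<kappa> C s \<omega> * total_gain \<xi> \<kappa> C t \<omega> \<partial>M) = pair_sum P \<xi> \<kappa> X Xk s t"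
proof -
  define G where "G p \<omega> = line_gain \<xi> \<kappa> s (fst p) (\<lambda>i. C (take i (fst p)) \<omega>) *
      line_gain \<xi> \<kappa> t (snd p) (\<lambda>i. C (take i (snd p)) \<omega>)" for p \<omega>
  define cls where "cls n m k p \<longleftrightarrow>
      length (fst p) = n \<and> length (snd p) = m \<and> diverge_at k (fst p) (snd p)" for n m k and p :: "nat list \<times> nat list"
  define F where "F k p \<omega> = line_gain \<xi> \<kappa> s (fst p) (\<lambda>i. X i \<omega>) * line_gain \<xi> \<kappa> t (snd p) (\<lambda>i. Xk k i \<omega>)" for k p \<omega>
  have Xk[measurable]: "\<And>k n. Xk k n \<in> measurable P E"
    and eq: "\<And>k. AE \<omega> in P. \<forall>n\<le>k. Xk k n \<omega> = X n \<omega>"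
    using pw unfolding pairwise_stationary_def by blast+
  have Gm: "G p \<in> borel_measurable M" for p
    unfolding G_def[abs_def] by (intro borel_measurable_times_ennreal cell_gain_measurable)
  have Fm: "F k p \<in> borel_measurable P" for k p
    unfolding F_def[abs_def]
    by (intro borel_measurable_times_ennreal measurable_compose[OF process_path_measurable line_gain_measurable]
        process_measurable Xk)
  \<comment> \<open>Each pair lies in exactly one class, given by the two generations and the
    divergence index, so any value equals its sum over the classes.\<close>
  have split: "c = (\<Sum>n. \<Sum>m. \<Sum>k<min (Suc n) (Suc m). if cls n m k p then c else 0)" for p and c :: ennreal
  proof -
    define n0 m0 where "n0 = length (fst p)" and "m0 = length (snd p)"
    have 1: "(\<Sum>k<min (Suc n) (Suc m). if cls n m k p then c else 0)
        = (if n = n0 then if m = m0 then c else 0 else 0)" for n m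
      using sum_diverge_at[of "fst p" "snd p" c] by (auto simp: cls_def n0_def m0_def)
    have 2: "(\<Sum>m. if n = n0 then if m = m0 then c else 0 else 0) = (if n = n0 then c else 0)" for n
      using suminf_finite[of "{m0}" "\<lambda>m. if m = m0 then c else 0"] by simp
    show ?thesis
      unfolding 1 2 using suminf_finite[of "{n0}" "\<lambda>n. if n = n0 then c else 0"] by simp
  qed
  have "(\<integral>\<^sup>+ \<omega>. total_gain \<xi> \<kappa> C s \<omega> * total_gain \<xi> \<kappa> C t \<omega> \<partial>M)
      = (\<integral>\<^sup>+ \<omega>. \<integral>\<^sup>+ p. G p \<omega> \<partial>count_space UNIV \<partial>M)"
    unfolding total_gain_def G_def nn_integral_fst_count_space[symmetric]
    by (simp add: nn_integral_cmult nn_integral_multc)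
  also have "\<dots> = (\<integral>\<^sup>+ p. \<integral>\<^sup>+ \<omega>. G p \<omega> \<partial>M \<partial>count_space UNIV)"
    by (intro nn_integral_count_space_nn_integral Gm) simp
  also have "\<dots> = (\<integral>\<^sup>+ p. (\<Sum>n. \<Sum>m. \<Sum>k<min (Suc n) (Suc m).
      if cls n m k p then \<integral>\<^sup>+ \<omega>. G p \<omega> \<partial>M else 0) \<partial>count_space UNIV)"
    by (intro nn_integral_cong split)
  also have "\<dots> = (\<Sum>n. \<Sum>m. \<Sum>k<min (Suc n) (Suc m).
      \<integral>\<^sup>+ p. (if cls n m k p then \<integral>\<^sup>+ \<omega>. G p \<omega> \<partial>M else 0) \<partial>count_space UNIV)"
    by (simp add: nn_integral_suminf nn_integral_sum del: sum.lessThan_Suc min_Suc_Suc)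
  also have "\<dots> = pair_sum P \<xi> \<kappa> X Xk s t"
    unfolding pair_sum_def
  proof (intro suminf_cong sum.cong refl)
    fix n m k assume "k \<in> {..<min (Suc n) (Suc m)}"
    then have k: "k \<le> n" "k \<le> m" by auto
    have "(\<integral>\<^sup>+ p. (if cls n m k p then \<integral>\<^sup>+ \<omega>. G p \<omega> \<partial>M else 0) \<partial>count_space UNIV)
       = (\<integral>\<^sup>+ p. \<integral>\<^sup>+ \<omega>. (if cls n m k p then F k p \<omega> else 0) \<partial>P \<partial>count_space UNIV)"
      using nn_integral_cell_gain_pair[OF pw]
      by (intro nn_integral_cong) (auto simp: cls_def G_def[abs_def] F_def)
    \<comment> \<open>The sum over pairs returns inside the expectation, now on \<open>P\<close>,
      where all pairs of the class see the same two paths and can be counted.\<close>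
    also have "\<dots> = (\<integral>\<^sup>+ \<omega>. \<integral>\<^sup>+ p. (if cls n m k p then F k p \<omega> else 0) \<partial>count_space UNIV \<partial>P)"
      using Fm by (intro nn_integral_count_space_nn_integral[symmetric]) auto
    also have "\<dots> = (\<integral>\<^sup>+ \<omega>. ennreal (pair_weight \<kappa> X (Xk k) (Suc n) (Suc m) k \<omega>)
       * indicator {\<omega>. split_time \<xi> X n \<omega> \<le> s \<and> split_time \<xi> (Xk k) m \<omega> \<le> t} \<omega> \<partial>P)"
    \<comment> \<open>The count needs \<open>Xk k\<close> and \<open>X\<close> to agree up to index
      \<open>k\<close>, which holds only almost surely.\<close>
    proof (rule nn_integral_cong_AE)
      show "AE \<omega> in P. (\<integral>\<^sup>+ p. (if cls n m k p then F k p \<omega> else 0) \<partial>count_space UNIV)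
        = ennreal (pair_weight \<kappa> X (Xk k) (Suc n) (Suc m) k \<omega>)
          * indicator {\<omega>. split_time \<xi> X n \<omega> \<le> s \<and> split_time \<xi> (Xk k) m \<omega> \<le> t} \<omega>"
        using eq[of k] AE_space
      proof eventually_elim
        case (elim \<omega>)
        have "1 \<le> \<kappa> (X i \<omega>)" "1 \<le> \<kappa> (Xk k i \<omega>)" for i
          using offspring_ge_2[of "X i \<omega>"] offspring_ge_2[of "Xk k i \<omega>"] elim(2)
            measurable_space[OF process_measurable] measurable_space[OF Xk] by fastforce+
        then show ?case
          unfolding cls_def F_def using elim(1) k by (intro nn_integral_line_gain_pairs) auto
      qed
    qed
    finally show "(\<integral>\<^sup>+ p. (if cls n m k p then \<integral>\<^sup>+ \<omega>. G p \<omega> \<partial>M else 0) \<partial>count_space UNIV)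
      = (\<integral>\<^sup>+ \<omega>. ennreal (pair_weight \<kappa> X (Xk k) (Suc n) (Suc m) k \<omega>)
       * indicator {\<omega>. split_time \<xi> X n \<omega> \<le> s \<and> split_time \<xi> (Xk k) m \<omega> \<le> t} \<omega> \<partial>P)" .
  qed
  finally show ?thesis .
qed

end

subsection \<open>Limits in quadratic mean and almost surely\<close>

lemma AE_summable_nn_integral:
  fixes f :: "nat \<Rightarrow> 'a \<Rightarrow> real"
  assumes f: "\<And>n. f n \<in> borel_measurable M" and nonneg: "\<And>n x. 0 \<le> f n x"
    and fin: "(\<Sum>n. \<integral>\<^sup>+ x. ennreal (f n x) \<partial>M) \<noteq> \<infinity>"
  shows "AE x in M. summable (\<lambda>n. f n x)"
proof -
  have "(\<integral>\<^sup>+ x. (\<Sum>n. ennreal (f n x)) \<partial>M) = (\<Sum>n. \<integral>\<^sup>+ x. ennreal (f n x) \<partial>M)"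
    using f by (intro nn_integral_suminf) auto
  then have "AE x in M. (\<Sum>n. ennreal (f n x)) \<noteq> \<infinity>"
    using f fin by (intro nn_integral_PInf_AE) auto
  then show ?thesis
    by eventually_elim (rule summable_suminf_not_top, use nonneg in auto)
qed

lemma ennreal_suminf_geometric_ne_top:
  assumes "\<And>n. a n \<le> ennreal (b * q ^ n)" "0 \<le> q" "q < 1" "0 \<le> b"
  shows "(\<Sum>n. a n) \<noteq> \<infinity>"
proof -
  have "(\<Sum>n. a n) \<le> (\<Sum>n. ennreal (b * q ^ n))"
    using assms(1) by (intro suminf_le) auto
  also have "\<dots> = ennreal (\<Sum>n. b * q ^ n)"
    using assms by (intro suminf_ennreal2 summable_mult summable_geometric) auto
  finally show ?thesis by (auto simp: top_unique)
qed

text \<open>A sufficiently fast subsequence converges almost surely; Fatou along it, with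
  \<open>t\<close> fixed, bounds the distance of its limit from \<open>Z t\<close>, and the term
  \<open>c (s n)\<close> disappears.\<close>

lemma L2_Cauchy_limit:
  fixes Z :: "real \<Rightarrow> 'a \<Rightarrow> real" and c :: "real \<Rightarrow> real"
  assumes meas [measurable]: "\<And>t. Z t \<in> borel_measurable M"
    and c0: "(c \<longlongrightarrow> 0) at_top"
    and cauchy: "\<And>s t. T \<le> t \<Longrightarrow> t \<le> s \<Longrightarrow>
      (\<integral>\<^sup>+ \<omega>. ennreal ((Z s \<omega> - Z t \<omega>)\<^sup>2) \<partial>M) \<le> ennreal (c t + c s)"
  obtains V where "V \<in> borel_measurable M"
    "\<And>t. T \<le> t \<Longrightarrow> (\<integral>\<^sup>+ \<omega>. ennreal ((V \<omega> - Z t \<omega>)\<^sup>2) \<partial>M) \<le> ennreal (c t)"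
proof -
  \<comment> \<open>The extra factor 1/2 makes the bounds at two consecutive times add up to at most
    \<open>(1/4) ^ n\<close>.\<close>
  have "\<exists>r. \<forall>u\<ge>r. c u \<le> (1/4) ^ n / 2" for n
  proof -
    have "eventually (\<lambda>u. c u < (1/4) ^ n / 2) at_top"
      by (rule order_tendstoD(2)[OF c0]) simp
    then show ?thesis unfolding eventually_at_top_linorder by (meson less_imp_le)
  qed
  then obtain r where r: "\<And>n u. r n \<le> u \<Longrightarrow> c u \<le> (1/4) ^ n / 2" by metis
  \<comment> \<open>The partial sums keep \<open>s\<close> increasing and beyond every
    \<open>r n\<close>; the other two terms keep it beyond \<open>T\<close> and send it to
    infinity.\<close>
  define s where "s n = \<bar>T\<bar> + real n + (\<Sum>i\<le>n. \<bar>r i\<bar>)" for n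
  have s_Suc: "s n \<le> s (Suc n)" for n by (simp add: s_def)
  have r_sum: "0 \<le> (\<Sum>i\<le>n. \<bar>r i\<bar>)" for n by (simp add: sum_nonneg)
  have T_le_s: "T \<le> s n" for n
    using r_sum[of n] abs_ge_self[of T] unfolding s_def by linarith
  have "r n \<le> s n" for n
    using member_le_sum[of n "{..n}" "\<lambda>i. \<bar>r i\<bar>"] by (simp add: s_def)
  then have c_s: "c (s n) \<le> (1/4) ^ n / 2" for n using r by blast
  have "real n \<le> s n" for n
    using r_sum[of n] abs_ge_self[of T] unfolding s_def by linarith
  then have s_top: "filterlim s at_top sequentially"
    by (intro filterlim_at_top_mono[OF filterlim_real_sequentially] always_eventually) simp
  define d where "d n \<omega> = Z (s (Suc n)) \<omega> - Z (s n) \<omega>" for n \<omega>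
  have [measurable]: "d n \<in> borel_measurable M" for n
    unfolding d_def[abs_def] by measurable
  \<comment> \<open>The weight \<open>2 ^ n\<close> uses up half of the decay rate: the weighted
    squares stay summable, and the weight later gives summability of the increments
    themselves.\<close>
  have "(\<integral>\<^sup>+ \<omega>. ennreal (2 ^ n * (d n \<omega>)\<^sup>2) \<partial>M) \<le> ennreal (1 * (1/2) ^ n)" for n
  proof -
    have "c (s n) + c (s (Suc n)) \<le> (1/4) ^ n"
      using c_s[of n] c_s[of "Suc n"] zero_le_power[of "1/4::real" n] unfolding power_Suc by linarith
    then have "(\<integral>\<^sup>+ \<omega>. ennreal ((d n \<omega>)\<^sup>2) \<partial>M) \<le> ennreal ((1/4) ^ n)"
      using order_trans[OF cauchy[OF T_le_s s_Suc] ennreal_leI] unfolding d_def by blast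
    then have "ennreal (2 ^ n) * (\<integral>\<^sup>+ \<omega>. ennreal ((d n \<omega>)\<^sup>2) \<partial>M) \<le> ennreal (2 ^ n) * ennreal ((1/4) ^ n)"
      by (intro mult_left_mono) auto
    also have "\<dots> = ennreal (1 * (1/2) ^ n)"
      by (simp add: ennreal_mult'[symmetric] power_mult_distrib[symmetric] del: ennreal_power)
    finally show ?thesis
      by (subst (asm) nn_integral_cmult[symmetric]) (simp_all add: ennreal_mult)
  qed
  then have "AE \<omega> in M. summable (\<lambda>n. 2 ^ n * (d n \<omega>)\<^sup>2)"
    by (intro AE_summable_nn_integral ennreal_suminf_geometric_ne_top[where b=1 and q="1/2"]) auto
  then have conv: "AE \<omega> in M. convergent (\<lambda>n. Z (s n) \<omega>)"
  proof eventually_elim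
    case (elim \<omega>)
    have "summable (\<lambda>n. (2 ^ n * (d n \<omega>)\<^sup>2 + (1/2) ^ n) / 2)"
      using elim by (intro summable_divide summable_add summable_geometric) auto
    \<comment> \<open>AM-GM with weight \<open>2 ^ n\<close>\<close>
    moreover have "norm (d n \<omega>) \<le> (2 ^ n * (d n \<omega>)\<^sup>2 + (1/2) ^ n) / 2" for n
    proof -
      have "0 \<le> 2 ^ n * (\<bar>d n \<omega>\<bar> - (1/2) ^ n)\<^sup>2" by simp
      also have "\<dots> = 2 ^ n * (d n \<omega>)\<^sup>2 + 2 ^ n * ((1/2) ^ n)\<^sup>2 - 2 * (2 ^ n * (1/2) ^ n) * \<bar>d n \<omega>\<bar>"
        by (simp only: power2_diff power2_abs) (simp add: algebra_simps)
      also have "(2::real) ^ n * ((1/2) ^ n)\<^sup>2 = (1/2) ^ n"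
        by (simp add: power2_eq_square power_mult_distrib[symmetric] mult.assoc[symmetric])
      also have "(2::real) ^ n * (1/2) ^ n = 1"
        by (simp add: power_mult_distrib[symmetric])
      finally show ?thesis by simp
    qed
    ultimately have "summable (\<lambda>n. d n \<omega>)"
      by (rule summable_comparison_test'[where N=0])
    then have "convergent (\<lambda>n. \<Sum>i<n. d i \<omega>)" by (simp add: summable_iff_convergent)
    moreover have "(\<Sum>i<n. d i \<omega>) = Z (s n) \<omega> - Z (s 0) \<omega>" for n
      unfolding d_def by (rule sum_lessThan_telescope)
    ultimately have "convergent (\<lambda>n. (Z (s n) \<omega> - Z (s 0) \<omega>) + Z (s 0) \<omega>)"
      by (intro convergent_add convergent_const) simp
    then show ?case by simp
  qed
  define V where "V \<omega> = lim (\<lambda>n. Z (s n) \<omega>)" for \<omega>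
  have [measurable]: "V \<in> borel_measurable M" unfolding V_def[abs_def] by measurable
  moreover have "(\<integral>\<^sup>+ \<omega>. ennreal ((V \<omega> - Z t \<omega>)\<^sup>2) \<partial>M) \<le> ennreal (c t)" if t: "T \<le> t" for t
  proof -
    have "(\<integral>\<^sup>+ \<omega>. ennreal ((V \<omega> - Z t \<omega>)\<^sup>2) \<partial>M)
        = (\<integral>\<^sup>+ \<omega>. liminf (\<lambda>n. ennreal ((Z (s n) \<omega> - Z t \<omega>)\<^sup>2)) \<partial>M)"
    proof (intro nn_integral_cong_AE)
      show "AE \<omega> in M. ennreal ((V \<omega> - Z t \<omega>)\<^sup>2) = liminf (\<lambda>n. ennreal ((Z (s n) \<omega> - Z t \<omega>)\<^sup>2))"
        using conv
      proof eventually_elim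
        case (elim \<omega>)
        then have "(\<lambda>n. Z (s n) \<omega>) \<longlonglongrightarrow> V \<omega>" by (simp add: convergent_LIMSEQ_iff V_def)
        then have "(\<lambda>n. ennreal ((Z (s n) \<omega> - Z t \<omega>)\<^sup>2)) \<longlonglongrightarrow> ennreal ((V \<omega> - Z t \<omega>)\<^sup>2)"
          by (intro tendsto_intros)
        then show ?case by (rule lim_imp_Liminf[OF sequentially_bot, symmetric])
      qed
    qed
    also have "\<dots> \<le> liminf (\<lambda>n. \<integral>\<^sup>+ \<omega>. ennreal ((Z (s n) \<omega> - Z t \<omega>)\<^sup>2) \<partial>M)"
      by (intro nn_integral_liminf) measurable
    also have "\<dots> \<le> liminf (\<lambda>n. ennreal (c t + c (s n)))"
    proof (rule Liminf_mono)
      have "eventually (\<lambda>n. t \<le> s n) sequentially"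
        using s_top by (simp add: filterlim_at_top)
      then show "eventually (\<lambda>n. (\<integral>\<^sup>+ \<omega>. ennreal ((Z (s n) \<omega> - Z t \<omega>)\<^sup>2) \<partial>M) \<le> ennreal (c t + c (s n))) sequentially"
        by eventually_elim (rule cauchy[OF t])
    qed
    also have "\<dots> = ennreal (c t)"
    proof (rule lim_imp_Liminf)
      have "(\<lambda>n. ennreal (c t + c (s n))) \<longlonglongrightarrow> ennreal (c t + 0)"
        by (intro tendsto_intros filterlim_compose[OF c0 s_top])
      then show "(\<lambda>n. ennreal (c t + c (s n))) \<longlonglongrightarrow> ennreal (c t)" by simp
    qed simp
    finally show ?thesis .
  qed
  ultimately show thesis by (rule that)
qed

text \<open>The squares from index \<open>N\<close> on have a finite expected sum, hence are almost
  surely summable.\<close>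

lemma AE_tendsto_0_of_geometric_L2:
  fixes Y :: "nat \<Rightarrow> 'a \<Rightarrow> real"
  assumes [measurable]: "\<And>n. Y n \<in> borel_measurable M"
    and bound: "\<And>n. N \<le> n \<Longrightarrow> (\<integral>\<^sup>+ \<omega>. ennreal ((Y n \<omega>)\<^sup>2) \<partial>M) \<le> ennreal (b * q ^ n)"
    and "0 \<le> q" "q < 1" "0 \<le> b"
  shows "AE \<omega> in M. (\<lambda>n. Y n \<omega>) \<longlonglongrightarrow> 0"
proof -
  have "(\<integral>\<^sup>+ \<omega>. ennreal ((Y (n + N) \<omega>)\<^sup>2) \<partial>M) \<le> ennreal ((b * q ^ N) * q ^ n)" for n
    using bound[of "n + N"] by (simp add: power_add mult_ac)
  then have "AE \<omega> in M. summable (\<lambda>n. (Y (n + N) \<omega>)\<^sup>2)"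
    using assms(3-5)
    by (intro AE_summable_nn_integral ennreal_suminf_geometric_ne_top[where b="b * q ^ N" and q=q]) auto
  then show ?thesis
  proof eventually_elim
    case (elim \<omega>)
    then have "(\<lambda>n. sqrt ((Y (n + N) \<omega>)\<^sup>2)) \<longlonglongrightarrow> sqrt 0"
      by (intro tendsto_real_sqrt summable_LIMSEQ_zero)
    then have "(\<lambda>n. Y (n + N) \<omega>) \<longlonglongrightarrow> 0"
      by (simp add: tendsto_rabs_zero_iff)
    then show ?case by (rule LIMSEQ_offset)
  qed
qed

section \<open>From grids to continuous time\<close>

text \<open>Between neighbouring grid points \<open>f\<close> is squeezed by monotonicity and the
  exponential changes by a factor of at most \<open>exp (\<nu> * h j)\<close>, which tends to 1 with
  the mesh.\<close>

lemma tendsto_exp_times_mono: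
  fixes f :: "real \<Rightarrow> real"
  assumes mono: "\<And>s t. s \<le> t \<Longrightarrow> f s \<le> f t" and nonneg: "\<And>t. 0 \<le> f t" and \<nu>: "0 \<le> \<nu>"
    and grid: "\<And>j::nat. (\<lambda>n. exp (- \<nu> * (real n / real (Suc j))) * f (real n / real (Suc j))) \<longlonglongrightarrow> L"
  shows "((\<lambda>t. exp (- \<nu> * t) * f t) \<longlongrightarrow> L) at_top"
proof -
  define z where "z t = exp (- \<nu> * t) * f t" for t
  define h where "h j = 1 / real (Suc j)" for j
  define m where "m j t = nat \<lfloor>t / h j\<rfloor>" for j t
  have h: "0 < h j" for j by (simp add: h_def)
  have h0: "h \<longlonglongrightarrow> 0" unfolding h_def[abs_def] using LIMSEQ_inverse_real_of_nat by (simp add: inverse_eq_divide)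
  have grid': "(\<lambda>n. z (real n * h j)) \<longlonglongrightarrow> L" for j
    using grid[of j] by (simp add: z_def h_def)
  have m_top: "filterlim (m j) sequentially at_top" for j
  proof -
    have "filterlim (\<lambda>t. t * (1 / h j)) at_top at_top"
      using h[of j] by (intro filterlim_at_top_mult_tendsto_pos[OF tendsto_const _ filterlim_ident]) simp
    then show ?thesis
      unfolding m_def[abs_def]
      by (intro filterlim_compose[OF filterlim_nat_sequentially] filterlim_compose[OF filterlim_floor_sequentially])
        simp
  qed
  have m: "real (m j t) * h j \<le> t" "t \<le> real (Suc (m j t)) * h j" if "0 \<le> t" for j t
  proof -
    have "real (m j t) = real_of_int \<lfloor>t / h j\<rfloor>" using that h[of j] by (simp add: m_def)
    then have "real (m j t) \<le> t / h j" "t / h j \<le> real (Suc (m j t))" by linarith+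
    then show "real (m j t) * h j \<le> t" "t \<le> real (Suc (m j t)) * h j"
      using h[of j] by (simp_all add: field_simps)
  qed
  have lower: "exp (- \<nu> * h j) * z (real (m j t) * h j) \<le> z t" if "0 \<le> t" for j t
  proof -
    have "exp (- \<nu> * h j) * z (real (m j t) * h j)
        = exp (- \<nu> * (real (Suc (m j t)) * h j)) * f (real (m j t) * h j)"
      by (simp add: z_def mult.assoc[symmetric] exp_add[symmetric]) (simp add: algebra_simps)
    also have "\<dots> \<le> exp (- \<nu> * t) * f t"
      using m[OF that, of j] \<nu> nonneg mono by (intro mult_mono) (auto simp: mult_left_mono)
    finally show ?thesis by (simp add: z_def)
  qed
  have upper: "z t \<le> exp (\<nu> * h j) * z (real (Suc (m j t)) * h j)" if "0 \<le> t" for j t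
  proof -
    have "z t \<le> exp (- \<nu> * (real (m j t) * h j)) * f (real (Suc (m j t)) * h j)"
      unfolding z_def
      using m[OF that, of j] \<nu> nonneg mono by (intro mult_mono) (auto simp: mult_left_mono)
    also have "\<dots> = exp (\<nu> * h j) * z (real (Suc (m j t)) * h j)"
      by (simp add: z_def mult.assoc[symmetric] exp_add[symmetric]) (simp add: algebra_simps)
    finally show ?thesis .
  qed
  have "(z \<longlongrightarrow> L) at_top"
  proof (rule order_tendstoI)
    fix a assume "a < L"
    \<comment> \<open>The mesh is fixed before \<open>t\<close> grows: \<open>j\<close> is taken so
      large that the factor still leaves the limit above \<open>a\<close>.\<close>
    have "(\<lambda>j. exp (- \<nu> * h j) * L) \<longlonglongrightarrow> exp (- \<nu> * 0) * L" by (intro tendsto_intros h0)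
    with \<open>a < L\<close> have "eventually (\<lambda>j. a < exp (- \<nu> * h j) * L) sequentially"
      by (intro order_tendstoD(1)) auto
    then obtain j where j: "a < exp (- \<nu> * h j) * L" by (auto simp: eventually_sequentially)
    have "((\<lambda>t. exp (- \<nu> * h j) * z (real (m j t) * h j)) \<longlongrightarrow> exp (- \<nu> * h j) * L) at_top"
      by (intro tendsto_intros filterlim_compose[OF grid' m_top])
    from order_tendstoD(1)[OF this j] eventually_ge_at_top[of 0]
    show "eventually (\<lambda>t. a < z t) at_top"
      by eventually_elim (use lower in \<open>meson less_le_trans\<close>)
  next
    fix a assume "L < a"
    have "(\<lambda>j. exp (\<nu> * h j) * L) \<longlonglongrightarrow> exp (\<nu> * 0) * L" by (intro tendsto_intros h0)
    with \<open>L < a\<close> have "eventually (\<lambda>j. exp (\<nu> * h j) * L < a) sequentially"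
      by (intro order_tendstoD(2)) auto
    then obtain j where j: "exp (\<nu> * h j) * L < a" by (auto simp: eventually_sequentially)
    have "((\<lambda>t. exp (\<nu> * h j) * z (real (Suc (m j t)) * h j)) \<longlongrightarrow> exp (\<nu> * h j) * L) at_top"
      by (intro tendsto_intros filterlim_compose[OF LIMSEQ_Suc[OF grid'] m_top])
    from order_tendstoD(2)[OF this j] eventually_ge_at_top[of 0]
    show "eventually (\<lambda>t. z t < a) at_top"
      by eventually_elim (use upper in \<open>meson le_less_trans\<close>)
  qed
  then show ?thesis by (simp add: z_def[abs_def])
qed

lemma integrable_square_add:
  fixes f g :: "'a \<Rightarrow> real"
  assumes [measurable]: "f \<in> borel_measurable M" "g \<in> borel_measurable M"
    and int: "integrable M (\<lambda>x. (f x)\<^sup>2)" "integrable M (\<lambda>x. (g x)\<^sup>2)"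
  shows "integrable M (\<lambda>x. (f x + g x)\<^sup>2)"
proof (rule Bochner_Integration.integrable_bound)
  show "integrable M (\<lambda>x. 2 * (f x)\<^sup>2 + 2 * (g x)\<^sup>2)" using int by simp
  have "(f x + g x)\<^sup>2 \<le> 2 * (f x)\<^sup>2 + 2 * (g x)\<^sup>2" for x
    using sum_squares_bound[of "f x" "g x"] by (simp add: power2_sum)
  then show "AE x in M. norm ((f x + g x)\<^sup>2) \<le> norm (2 * (f x)\<^sup>2 + 2 * (g x)\<^sup>2)" by simp
qed measurable

subsection \<open>Convergence of the normalised population\<close>

lemma malthusian_nonneg: "malthusian P \<xi> \<kappa> X = ereal \<nu> \<Longrightarrow> 0 \<le> \<nu>"
proof -
  assume "malthusian P \<xi> \<kappa> X = ereal \<nu>"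
  moreover have "0 \<le> malthusian P \<xi> \<kappa> X"
    unfolding malthusian_def by (rule Inf_greatest) auto
  ultimately show "0 \<le> \<nu>" by simp
qed

lemma pair_deviation_nonneg: "0 \<le> pair_deviation P \<xi> \<kappa> X Xk \<nu> K t"
  unfolding pair_deviation_def by (rule SUP_upper2[of 0]) auto

text \<open>Choose \<open>\<tau> = s - t\<close> in the supremum; an infinite pair sum would make
  the deviation infinite, so finiteness comes for free.\<close>

lemma pair_sum_of_pair_deviation_le:
  assumes dev: "pair_deviation P \<xi> \<kappa> X Xk \<nu> K t \<le> ereal d" and "t \<le> s"
  obtains r where "0 \<le> r" "pair_sum P \<xi> \<kappa> X Xk t s = ennreal r"
    "\<bar>exp (- \<nu> * (t + s)) * r - K\<bar> \<le> d"
proof -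
  have "\<bar>ereal (exp (- \<nu> * (2 * t + (s - t)))) * enn2ereal (pair_sum P \<xi> \<kappa> X Xk t (t + (s - t))) - ereal K\<bar>
      \<le> pair_deviation P \<xi> \<kappa> X Xk \<nu> K t"
    unfolding pair_deviation_def using \<open>t \<le> s\<close> by (intro SUP_upper) simp
  also note dev
  finally have *: "\<bar>ereal (exp (- \<nu> * (t + s))) * enn2ereal (pair_sum P \<xi> \<kappa> X Xk t s) - ereal K\<bar> \<le> ereal d"
    by (simp add: add.assoc)
  show thesis
  proof (cases "pair_sum P \<xi> \<kappa> X Xk t s")
    case (real r)
    then show thesis using * by (intro that[of r]) (simp_all add: enn2ereal_ennreal)
  next
    case top
    then show thesis using * by simp
  qed
qed

section \<open>Finiteness and distances of the normalised gain\<close>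

context branching_model
begin

text \<open>Finite second moments give finiteness at the countably many times \<open>T + n\<close>;
  monotonicity in time extends it to all times outside one null set.\<close>

lemma AE_total_gain_finite:
  assumes pw: "pairwise_stationary M P E C X Xk"
    and fin: "\<And>t. T \<le> t \<Longrightarrow> pair_sum P \<xi> \<kappa> X Xk t t < \<infinity>"
  shows "AE \<omega> in M. \<forall>t. total_gain \<xi> \<kappa> C t \<omega> < \<infinity>"
proof -
  have "AE \<omega> in M. total_gain \<xi> \<kappa> C (T + real n) \<omega> < \<infinity>" for n
  proof -
    have "AE \<omega> in M. total_gain \<xi> \<kappa> C (T + real n) \<omega> * total_gain \<xi> \<kappa> C (T + real n) \<omega> \<noteq> \<infinity>"
    proof (rule nn_integral_PInf_AE)
      show "(\<lambda>\<omega>. total_gain \<xi> \<kappa> C (T + real n) \<omega> * total_gain \<xi> \<kappa> C (T + real n) \<omega>) \<in> borel_measurable M"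
        by (intro borel_measurable_times_ennreal total_gain_measurable)
    qed (use second_moment_total_gain[OF pw] fin[of "T + real n"] in auto)
    then show ?thesis
      by eventually_elim (auto simp: ennreal_mult_eq_top_iff less_top)
  qed
  then have "AE \<omega> in M. \<forall>n. total_gain \<xi> \<kappa> C (T + real n) \<omega> < \<infinity>"
    by (simp add: AE_all_countable)
  then show ?thesis
  proof eventually_elim
    case (elim \<omega>)
    show ?case
    proof
      fix t
      obtain n where "t - T \<le> real n" using real_arch_simple by blast
      then have "total_gain \<xi> \<kappa> C t \<omega> \<le> total_gain \<xi> \<kappa> C (T + real n) \<omega>"
        by (intro total_gain_mono) simp
      with elim show "total_gain \<xi> \<kappa> C t \<omega> < \<infinity>" using le_less_trans by blast
    qed
  qed
qed

text \<open>The summand \<open>exp (- \<nu> * t)\<close> is the contribution of the initial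
  cell.\<close>

lemma normalized_num_alive_eq:
  assumes "\<omega> \<in> space M" "0 \<le> t" "total_gain \<xi> \<kappa> C t \<omega> < \<infinity>"
  shows "normalized_num_alive \<xi> \<kappa> C \<nu> t \<omega> =
    ereal (exp (- \<nu> * t) * enn2real (total_gain \<xi> \<kappa> C t \<omega>) + exp (- \<nu> * t))"
proof -
  have "num_alive \<xi> \<kappa> C t \<omega> = 1 + total_gain \<xi> \<kappa> C t \<omega>"
    using assms measurable_space[OF cell_measurable assms(1)]
    by (intro num_alive_eq_total_gain) (auto intro: offspring_ge_2 lifetime_nonneg)
  also have "\<dots> = ennreal (1 + enn2real (total_gain \<xi> \<kappa> C t \<omega>))"
    using assms(3) by (simp add: ennreal_plus)
  finally have "enn2ereal (num_alive \<xi> \<kappa> C t \<omega>) = ereal (1 + enn2real (total_gain \<xi> \<kappa> C t \<omega>))"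
    using enn2ereal_ennreal[of "1 + enn2real (total_gain \<xi> \<kappa> C t \<omega>)"] by (simp del: ennreal_plus)
  then show ?thesis
    by (simp add: normalized_num_alive_def algebra_simps)
qed

lemma has_bochner_integral_total_gain_mult:
  assumes pw: "pairwise_stationary M P E C X Xk"
    and fin: "AE \<omega> in M. \<forall>t. total_gain \<xi> \<kappa> C t \<omega> < \<infinity>"
    and r: "pair_sum P \<xi> \<kappa> X Xk t s = ennreal r" "0 \<le> r"
  shows "has_bochner_integral M
    (\<lambda>\<omega>. enn2real (total_gain \<xi> \<kappa> C t \<omega>) * enn2real (total_gain \<xi> \<kappa> C s \<omega>)) r"
proof (rule has_bochner_integral_nn_integral)
  have "(\<integral>\<^sup>+ \<omega>. ennreal (enn2real (total_gain \<xi> \<kappa> C t \<omega>) * enn2real (total_gain \<xi> \<kappa> C s \<omega>)) \<partial>M)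
      = (\<integral>\<^sup>+ \<omega>. total_gain \<xi> \<kappa> C t \<omega> * total_gain \<xi> \<kappa> C s \<omega> \<partial>M)"
  proof (intro nn_integral_cong_AE)
    show "AE \<omega> in M. ennreal (enn2real (total_gain \<xi> \<kappa> C t \<omega>) * enn2real (total_gain \<xi> \<kappa> C s \<omega>))
        = total_gain \<xi> \<kappa> C t \<omega> * total_gain \<xi> \<kappa> C s \<omega>"
      using fin by eventually_elim (simp add: ennreal_mult)
  qed
  then show "(\<integral>\<^sup>+ \<omega>. ennreal (enn2real (total_gain \<xi> \<kappa> C t \<omega>) * enn2real (total_gain \<xi> \<kappa> C s \<omega>)) \<partial>M)
      = ennreal r"
    using second_moment_total_gain[OF pw] r by simp
qed (use total_gain_measurable r in \<open>auto intro!: borel_measurable_times borel_measurable_enn2real\<close>)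

text \<open>Expanding the square gives three moments with coefficients 1, -2, 1, each close to
  \<open>K\<close>, so \<open>K\<close> cancels and only the errors remain.\<close>

lemma L2_distance_total_gain:
  assumes pw: "pairwise_stationary M P E C X Xk"
    and fin: "AE \<omega> in M. \<forall>t. total_gain \<xi> \<kappa> C t \<omega> < \<infinity>"
    and dev: "\<And>t. T \<le> t \<Longrightarrow> pair_deviation P \<xi> \<kappa> X Xk \<nu> K t \<le> ereal (d t)"
    and "T \<le> t" "t \<le> s"
  defines "Z \<equiv> \<lambda>t \<omega>. exp (- \<nu> * t) * enn2real (total_gain \<xi> \<kappa> C t \<omega>)"
  shows "(\<integral>\<^sup>+ \<omega>. ennreal ((Z s \<omega> - Z t \<omega>)\<^sup>2) \<partial>M) \<le> ennreal (3 * d t + d s)"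
proof -
  \<comment> \<open>The error is governed by the earlier time \<open>u\<close>, so the mixed moment
    costs \<open>2 * d t\<close> and not \<open>d s\<close>.\<close>
  have moment: "\<exists>m. has_bochner_integral M (\<lambda>\<omega>. Z u \<omega> * Z v \<omega>) m \<and> \<bar>m - K\<bar> \<le> d u"
    if uv: "T \<le> u" "u \<le> v" for u v
  proof -
    obtain r where r: "0 \<le> r" "pair_sum P \<xi> \<kappa> X Xk u v = ennreal r" "\<bar>exp (- \<nu> * (u + v)) * r - K\<bar> \<le> d u"
      by (rule pair_sum_of_pair_deviation_le[OF dev[OF uv(1)] uv(2)])
    have "has_bochner_integral M (\<lambda>\<omega>. exp (- \<nu> * (u + v)) *
        (enn2real (total_gain \<xi> \<kappa> C u \<omega>) * enn2real (total_gain \<xi> \<kappa> C v \<omega>))) (exp (- \<nu> * (u + v)) * r)"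
      by (intro has_bochner_integral_mult_right has_bochner_integral_total_gain_mult[OF pw fin] r)
    moreover have "exp (- \<nu> * (u + v)) = exp (- \<nu> * u) * exp (- \<nu> * v)"
      by (simp add: exp_add[symmetric] algebra_simps)
    ultimately show ?thesis using r(3) by (auto simp: Z_def mult_ac)
  qed
  have "T \<le> s" using assms by simp
  obtain m\<^sub>1 m\<^sub>2 m\<^sub>3 where
    m1: "has_bochner_integral M (\<lambda>\<omega>. Z s \<omega> * Z s \<omega>) m\<^sub>1" "\<bar>m\<^sub>1 - K\<bar> \<le> d s" and
    m2: "has_bochner_integral M (\<lambda>\<omega>. Z t \<omega> * Z s \<omega>) m\<^sub>2" "\<bar>m\<^sub>2 - K\<bar> \<le> d t" and
    m3: "has_bochner_integral M (\<lambda>\<omega>. Z t \<omega> * Z t \<omega>) m\<^sub>3" "\<bar>m\<^sub>3 - K\<bar> \<le> d t"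
    using moment[OF \<open>T \<le> s\<close> order_refl] moment[OF \<open>T \<le> t\<close> \<open>t \<le> s\<close>] moment[OF \<open>T \<le> t\<close> order_refl]
    by blast
  have "has_bochner_integral M (\<lambda>\<omega>. Z s \<omega> * Z s \<omega> - 2 * (Z t \<omega> * Z s \<omega>) + Z t \<omega> * Z t \<omega>) (m\<^sub>1 - 2 * m\<^sub>2 + m\<^sub>3)"
    by (intro has_bochner_integral_add has_bochner_integral_diff has_bochner_integral_mult_right m1 m2 m3)
  then have "has_bochner_integral M (\<lambda>\<omega>. (Z s \<omega> - Z t \<omega>)\<^sup>2) (m\<^sub>1 - 2 * m\<^sub>2 + m\<^sub>3)"
    by (simp add: power2_eq_square algebra_simps)
  then have "(\<integral>\<^sup>+ \<omega>. ennreal ((Z s \<omega> - Z t \<omega>)\<^sup>2) \<partial>M) = ennreal (m\<^sub>1 - 2 * m\<^sub>2 + m\<^sub>3)"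
    by (subst nn_integral_eq_integral) (auto simp: has_bochner_integral_iff)
  also have "\<dots> \<le> ennreal (3 * d t + d s)"
    using m1(2) m2(2) m3(2) by (intro ennreal_leI) linarith
  finally show ?thesis .
qed

end

theorem corollary3p3:
  fixes M :: "'w measure" and P :: "'p measure" and E :: "'x measure"
    and \<xi> :: "'x \<Rightarrow> real" and \<kappa> :: "'x \<Rightarrow> nat"
    and C :: "nat list \<Rightarrow> 'w \<Rightarrow> 'x"
    and X :: "nat \<Rightarrow> 'p \<Rightarrow> 'x" and Xk :: "nat \<Rightarrow> nat \<Rightarrow> 'p \<Rightarrow> 'x"
    and \<nu> K :: real
  assumes model: "branching_model M P E \<xi> \<kappa> C X"
    and pairwise: "pairwise_stationary M P E C X Xk"
    and nu_finite: "malthusian P \<xi> \<kappa> X = ereal \<nu>"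
    and first_moment:
      "Limsup at_top (\<lambda>t::real. ennreal (exp (- \<nu> * t)) * (\<integral>\<^sup>+ \<omega>. num_alive \<xi> \<kappa> C t \<omega> \<partial>M)) < \<infinity>"
    and K_pos: "0 < K"
    and second_moment: "((\<lambda>t. pair_deviation P \<xi> \<kappa> X Xk \<nu> K t) \<longlongrightarrow> 0) at_top"
  shows "\<exists>W :: 'w \<Rightarrow> real.
      W \<in> borel_measurable M \<and> integrable M (\<lambda>\<omega>. (W \<omega>)\<^sup>2) \<and>
      converges_in_quadratic_mean M (normalized_num_alive \<xi> \<kappa> C \<nu>) W \<and>
      ((\<exists>\<epsilon>>0. \<exists>B::real. \<forall>\<^sub>F t in at_top.
           pair_deviation P \<xi> \<kappa> X Xk \<nu> K t \<le> ereal (B * exp (- \<epsilon> * t))) \<and>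
       (AE \<omega> in M. 0 < W \<omega>)
       \<longrightarrow> converges_almost_surely M (normalized_num_alive \<xi> \<kappa> C \<nu>) W)"
proof -
  interpret branching_model M P E \<xi> \<kappa> C X by (rule model)
  let ?dev = "pair_deviation P \<xi> \<kappa> X Xk \<nu> K"
  have \<nu>: "0 \<le> \<nu>" using nu_finite by (rule malthusian_nonneg)
  define d where "d t = real_of_ereal (?dev t)" for t
  define D where "D t \<omega> = enn2real (total_gain \<xi> \<kappa> C t \<omega>)" for t \<omega>
  define Z where "Z t \<omega> = exp (- \<nu> * t) * D t \<omega>" for t \<omega>
  have [measurable]: "Z t \<in> borel_measurable M" for t
    unfolding Z_def[abs_def] D_def using total_gain_measurable by measurable
  \<comment> \<open>Any finite bound would do: it makes the deviation real-valued from
    \<open>T\<close> on.\<close>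
  have "eventually (\<lambda>t. ?dev t < 1) at_top"
    by (rule order_tendstoD(2)[OF second_moment]) simp
  then obtain T where T: "\<And>t. T \<le> t \<Longrightarrow> ?dev t < 1"
    by (auto simp: eventually_at_top_linorder)
  have dev: "?dev t = ereal (d t)" if "T \<le> t" for t
    using T[OF that] pair_deviation_nonneg[of P \<xi> \<kappa> X Xk \<nu> K t]
    unfolding d_def by (cases "?dev t") auto
  have d_nonneg: "0 \<le> d t" for t
    unfolding d_def by (intro real_of_ereal_pos pair_deviation_nonneg)
  have d0: "(d \<longlongrightarrow> 0) at_top"
    unfolding d_def[abs_def] using lim_real_of_ereal[of "?dev" 0] second_moment
    by (simp add: zero_ereal_def)
  have dev': "?dev t \<le> ereal (d t)" if "T \<le> t" for t
    using dev[OF that] by simp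
  have "pair_sum P \<xi> \<kappa> X Xk t t < \<infinity>" if "T \<le> t" for t
    using pair_sum_of_pair_deviation_le[OF dev'[OF that] order_refl]
    by (metis ennreal_less_top infinity_ennreal_def)
  then have fin: "AE \<omega> in M. \<forall>t. total_gain \<xi> \<kappa> C t \<omega> < \<infinity>"
    by (rule AE_total_gain_finite[OF pairwise])
  have L2: "(\<integral>\<^sup>+ \<omega>. ennreal ((Z s \<omega> - Z t \<omega>)\<^sup>2) \<partial>M) \<le> ennreal (3 * d t + 3 * d s)"
    if "T \<le> t" "t \<le> s" for s t
  proof -
    have "(\<integral>\<^sup>+ \<omega>. ennreal ((Z s \<omega> - Z t \<omega>)\<^sup>2) \<partial>M) \<le> ennreal (3 * d t + d s)"
      unfolding Z_def D_def by (rule L2_distance_total_gain[OF pairwise fin dev' that])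
    \<comment> \<open>Weakened to the symmetric form \<open>c t + c s\<close> with
      \<open>c = 3 * d\<close>, as \<open>L2_Cauchy_limit\<close> expects.\<close>
    also have "\<dots> \<le> ennreal (3 * d t + 3 * d s)"
      using d_nonneg[of s] by (intro ennreal_leI) simp
    finally show ?thesis .
  qed
  have "((\<lambda>t. 3 * d t) \<longlongrightarrow> 0) at_top"
    using tendsto_mult_right_zero[OF d0] .
  then obtain V where V[measurable]: "V \<in> borel_measurable M"
    and VZ: "\<And>t. T \<le> t \<Longrightarrow> (\<integral>\<^sup>+ \<omega>. ennreal ((V \<omega> - Z t \<omega>)\<^sup>2) \<partial>M) \<le> ennreal (3 * d t)"
    using L2_Cauchy_limit[of Z M "\<lambda>t. 3 * d t" T] L2 by auto
  \<comment> \<open>only \<open>0 \<le> \<nu>\<close> is known, and for \<open>\<nu> = 0\<close> the initial cell survives the normalisation\<close>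
  define L :: real where "L = (if \<nu> = 0 then 1 else 0)"
  have expL: "((\<lambda>t. exp (- \<nu> * t)) \<longlongrightarrow> L) at_top"
  proof (cases "\<nu> = 0")
    case False
    then have "filterlim (\<lambda>t. - \<nu> * t) at_bot at_top"
      using \<nu> by (intro filterlim_tendsto_neg_mult_at_bot[OF tendsto_const _ filterlim_ident]) simp
    then show ?thesis
      using False filterlim_compose[OF exp_at_bot] by (simp add: L_def)
  qed (simp add: L_def)
  \<comment> \<open>\<open>V\<close> is the limit of the gain part, \<open>L\<close> that of the
    normalised initial cell.\<close>
  define W where "W \<omega> = V \<omega> + L" for \<omega>
  have num: "AE \<omega> in M. \<forall>t\<ge>0. normalized_num_alive \<xi> \<kappa> C \<nu> t \<omega> = ereal (Z t \<omega> + exp (- \<nu> * t))"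
    using fin AE_space by eventually_elim (simp add: normalized_num_alive_eq Z_def D_def)
  have "W \<in> borel_measurable M" unfolding W_def[abs_def] by measurable
  moreover have "integrable M (\<lambda>\<omega>. (W \<omega>)\<^sup>2)"
  proof -
    have "integrable M (\<lambda>\<omega>. (V \<omega> - Z T \<omega>)\<^sup>2)"
      using VZ[of T] by (intro integrableI_nonneg) (auto intro: le_less_trans)
    moreover have "integrable M (\<lambda>\<omega>. (Z T \<omega>)\<^sup>2)"
    proof -
      obtain r where "0 \<le> r" "pair_sum P \<xi> \<kappa> X Xk T T = ennreal r"
        using pair_sum_of_pair_deviation_le[OF dev' order_refl] by blast
      then have "has_bochner_integral M (\<lambda>\<omega>. D T \<omega> * D T \<omega>) r"
        unfolding D_def by (intro has_bochner_integral_total_gain_mult[OF pairwise fin])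
      then have "integrable M (\<lambda>\<omega>. (exp (- \<nu> * T))\<^sup>2 * (D T \<omega> * D T \<omega>))"
        by (intro integrable_mult_right) (auto simp: has_bochner_integral_iff)
      then show ?thesis by (simp add: Z_def power_mult_distrib power2_eq_square[of "D T _"])
    qed
    ultimately have "integrable M (\<lambda>\<omega>. ((V \<omega> - Z T \<omega>) + Z T \<omega>)\<^sup>2)"
      by (intro integrable_square_add) measurable
    then show ?thesis
      unfolding W_def using integrable_square_add[of V M "\<lambda>_. L"] by simp
  qed
  moreover have "converges_in_quadratic_mean M (normalized_num_alive \<xi> \<kappa> C \<nu>) W"
    unfolding converges_in_quadratic_mean_def
  proof (rule tendsto_sandwich[where f="\<lambda>_. 0"])
    have bound: "(\<integral>\<^sup>+ \<omega>. e2ennreal (\<bar>normalized_num_alive \<xi> \<kappa> C \<nu> t \<omega> - ereal (W \<omega>)\<bar>\<^sup>2) \<partial>M)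
        \<le> ennreal (2 * (3 * d t) + 2 * (exp (- \<nu> * t) - L)\<^sup>2)" if t: "max T 0 \<le> t" for t
    proof -
      have "(\<integral>\<^sup>+ \<omega>. e2ennreal (\<bar>normalized_num_alive \<xi> \<kappa> C \<nu> t \<omega> - ereal (W \<omega>)\<bar>\<^sup>2) \<partial>M)
        \<le> (\<integral>\<^sup>+ \<omega>. 2 * ennreal ((V \<omega> - Z t \<omega>)\<^sup>2) + ennreal (2 * (exp (- \<nu> * t) - L)\<^sup>2) \<partial>M)"
      proof (rule nn_integral_mono_AE)
        show "AE \<omega> in M. e2ennreal (\<bar>normalized_num_alive \<xi> \<kappa> C \<nu> t \<omega> - ereal (W \<omega>)\<bar>\<^sup>2)
           \<le> 2 * ennreal ((V \<omega> - Z t \<omega>)\<^sup>2) + ennreal (2 * (exp (- \<nu> * t) - L)\<^sup>2)"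
          using num
        proof eventually_elim
          case (elim \<omega>)
          \<comment> \<open>\<open>x\<close> is the random error of the gain part and
            \<open>y\<close> the deterministic error of the initial cell; the bound below is
            \<open>(x + y)\<^sup>2 \<ge> 0\<close> rearranged.\<close>
          define x y where "x = V \<omega> - Z t \<omega>" and "y = exp (- \<nu> * t) - L"
          have "normalized_num_alive \<xi> \<kappa> C \<nu> t \<omega> - ereal (W \<omega>) = ereal (y - x)"
            using elim t by (simp add: W_def x_def y_def)
          then have "e2ennreal (\<bar>normalized_num_alive \<xi> \<kappa> C \<nu> t \<omega> - ereal (W \<omega>)\<bar>\<^sup>2) = ennreal ((y - x)\<^sup>2)"
            by (simp add: ereal_power e2ennreal_ereal)
          also have "\<dots> \<le> ennreal (2 * x\<^sup>2 + 2 * y\<^sup>2)"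
            using zero_le_power2[of "x + y"]
            by (intro ennreal_leI) (simp add: power2_sum power2_diff algebra_simps)
          also have "\<dots> = 2 * ennreal (x\<^sup>2) + ennreal (2 * y\<^sup>2)"
            by (simp add: ennreal_mult')
          finally show ?case by (simp add: x_def y_def)
        qed
      qed
      also have "\<dots> = 2 * (\<integral>\<^sup>+ \<omega>. ennreal ((V \<omega> - Z t \<omega>)\<^sup>2) \<partial>M) + ennreal (2 * (exp (- \<nu> * t) - L)\<^sup>2)"
        by (simp add: nn_integral_add nn_integral_cmult cells.emeasure_space_1)
      also have "\<dots> \<le> 2 * ennreal (3 * d t) + ennreal (2 * (exp (- \<nu> * t) - L)\<^sup>2)"
        using VZ[of t] t by (intro add_right_mono mult_left_mono) auto
      also have "\<dots> = ennreal (2 * (3 * d t) + 2 * (exp (- \<nu> * t) - L)\<^sup>2)"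
        using d_nonneg[of t] by (simp add: ennreal_plus ennreal_mult')
      finally show ?thesis .
    qed
    then show "\<forall>\<^sub>F t in at_top. (\<integral>\<^sup>+ \<omega>. e2ennreal (\<bar>normalized_num_alive \<xi> \<kappa> C \<nu> t \<omega> - ereal (W \<omega>)\<bar>\<^sup>2) \<partial>M)
        \<le> ennreal (2 * (3 * d t) + 2 * (exp (- \<nu> * t) - L)\<^sup>2)"
      unfolding eventually_at_top_linorder by blast
    have "((\<lambda>t. ennreal (2 * (3 * d t) + 2 * (exp (- \<nu> * t) - L)\<^sup>2))
        \<longlongrightarrow> ennreal (2 * (3 * 0) + 2 * (L - L)\<^sup>2)) at_top"
      by (intro tendsto_intros d0 expL)
    then show "((\<lambda>t. ennreal (2 * (3 * d t) + 2 * (exp (- \<nu> * t) - L)\<^sup>2)) \<longlongrightarrow> 0) at_top"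
      by simp
  qed auto
  moreover have "converges_almost_surely M (normalized_num_alive \<xi> \<kappa> C \<nu>) W"
    if rate: "\<exists>\<epsilon>>0. \<exists>B::real. \<forall>\<^sub>F t in at_top. ?dev t \<le> ereal (B * exp (- \<epsilon> * t))"
  proof -
    obtain \<epsilon> B T' where \<epsilon>: "0 < \<epsilon>" and T': "\<And>t. T' \<le> t \<Longrightarrow> ?dev t \<le> ereal (B * exp (- \<epsilon> * t))"
      using rate unfolding eventually_at_top_linorder by blast
    \<comment> \<open>The absolute value provides the nonnegative constant required for the
      geometric bound.\<close>
    have d_le: "d t \<le> \<bar>B\<bar> * exp (- \<epsilon> * t)" if "max T T' \<le> t" for t
    proof -
      have "d t \<le> B * exp (- \<epsilon> * t)" using T'[of t] dev[of t] that by simp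
      also have "\<dots> \<le> \<bar>B\<bar> * exp (- \<epsilon> * t)" by (intro mult_right_mono) auto
      finally show ?thesis .
    qed
    have "AE \<omega> in M. (\<lambda>n. V \<omega> - Z (real n / real (Suc j)) \<omega>) \<longlonglongrightarrow> 0" for j
    \<comment> \<open>On the grid of mesh \<open>1 / Suc j\<close>, exponential decay in time is
      geometric decay in \<open>n\<close>, with ratio
      \<open>exp (- \<epsilon> / real (Suc j))\<close>.\<close>
    proof (rule AE_tendsto_0_of_geometric_L2[where b="3 * \<bar>B\<bar>" and q="exp (- \<epsilon> / real (Suc j))"])
      fix n assume n: "nat \<lceil>max T T' * real (Suc j)\<rceil> \<le> n"
      define t where "t = real n / real (Suc j)"
      have "max T T' * real (Suc j) \<le> real n" using n by linarith
      then have t: "max T T' \<le> t"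
        by (simp only: t_def pos_le_divide_eq of_nat_0_less_iff zero_less_Suc)
      have "(\<integral>\<^sup>+ \<omega>. ennreal ((V \<omega> - Z t \<omega>)\<^sup>2) \<partial>M) \<le> ennreal (3 * d t)"
        using VZ[of t] t by simp
      also have "\<dots> \<le> ennreal (3 * (\<bar>B\<bar> * exp (- \<epsilon> * t)))"
        using d_le[OF t] by (intro ennreal_leI) simp
      also have "3 * (\<bar>B\<bar> * exp (- \<epsilon> * t)) = 3 * \<bar>B\<bar> * exp (- \<epsilon> / real (Suc j)) ^ n"
        by (simp add: t_def exp_of_nat_mult[symmetric])
      finally show "(\<integral>\<^sup>+ \<omega>. ennreal ((V \<omega> - Z (real n / real (Suc j)) \<omega>)\<^sup>2) \<partial>M)
          \<le> ennreal (3 * \<bar>B\<bar> * exp (- \<epsilon> / real (Suc j)) ^ n)"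
        unfolding t_def .
    qed (use \<epsilon> in auto)
    \<comment> \<open>There are countably many meshes, so one null set serves all of them.\<close>
    then have "AE \<omega> in M. \<forall>j. (\<lambda>n. V \<omega> - Z (real n / real (Suc j)) \<omega>) \<longlonglongrightarrow> 0"
      by (simp add: AE_all_countable)
    then show ?thesis
      unfolding converges_almost_surely_def using num fin
    proof eventually_elim
      case (elim \<omega>)
      have "((\<lambda>t. exp (- \<nu> * t) * D t \<omega>) \<longlongrightarrow> V \<omega>) at_top"
      proof (rule tendsto_exp_times_mono)
        show "D s \<omega> \<le> D t \<omega>" if "s \<le> t" for s t
          unfolding D_def using elim(3) total_gain_mono[OF that]
          by (intro enn2real_mono) (auto simp: less_top)
        show "(\<lambda>n. exp (- \<nu> * (real n / real (Suc j))) * D (real n / real (Suc j)) \<omega>) \<longlonglongrightarrow> V \<omega>" for j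
          using tendsto_diff[OF tendsto_const[of "V \<omega>"] spec[OF elim(1), of j]] by (simp add: Z_def)
      qed (auto simp: D_def \<nu>)
      then have "((\<lambda>t. ereal (Z t \<omega> + exp (- \<nu> * t))) \<longlongrightarrow> ereal (W \<omega>)) at_top"
        unfolding W_def Z_def by (intro tendsto_intros expL)
      moreover have "\<forall>\<^sub>F t in at_top. ereal (Z t \<omega> + exp (- \<nu> * t)) = normalized_num_alive \<xi> \<kappa> C \<nu> t \<omega>"
        using eventually_ge_at_top[of 0] by eventually_elim (use elim(2) in simp)
      ultimately show ?case by (rule Lim_transform_eventually)
    qed
  qed
  ultimately show ?thesis by blast
qed

end
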